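(* Let $(D,D^+,u)$ be a countable unital simple dimension group with $D\not\cong\mathbb Z$, such that $D/2D\cong\mathbb Z/2$ and $u\in2D$. Let $\mathcal G:=X\rtimes_\phi\mathbb Z$ be the transformation groupoid of a minimal $\mathbb Z$-action $\phi$ on a Cantor set $X$ with $H_0(\mathcal G)\cong D$ as unital dimension groups, and let $\lambda:\mathbb Z/2\curvearrowright\mathcal G$ be an action arising from a homeomorphism of $X$ of order $2$ commuting with $\phi$, such that the induced action of $\mathbb Z/2$ on $H_0(\mathcal G)$ is trivial. Put $\mathcal H:=\mathcal G\rtimes_\lambda\mathbb Z/2$, let $a\in\mathbb Z/2$ be the nontrivial element, and let $M:=\mathsf D(\mathcal G)\sqcup\mathsf D(\mathcal G)\beta\lambda_a\subset\mathsf D(\mathcal H)$, where $\beta\in\mathsf F(\mathcal G)$ is any element with $\beta\lambda_a\in\mathsf D(\mathcal H)$. Suppose that $u\notin4D$. Then the extension \[1\to\mathsf D(\mathcal G)\to M\to\mathbb Z/2\to1\] does not split.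
   Context: For a homeomorphism $\phi$ of a Cantor set $X$ generating a minimal $\mathbb Z$-action (all orbits dense), $X\rtimes_\phi\mathbb Z$ is $X\times\mathbb Z$ with the product topology, $r(x,n)=x$, $s(x,n)=\phi^{-n}(x)$, $(x,n)(\phi^{-n}(x),m)=(x,n+m)$, and unit space $X$. $H_0(\mathcal G)=C(X,\mathbb Z)/\{f\circ\phi-f\}$, ordered by the cone of classes of nonnegative functions, with order unit $[1_X]$. A unital dimension group is a countable, directed, unperforated ordered abelian group with the Riesz interpolation property, with a distinguished order unit $u$; it is simple if every nonzero positive element is an order unit. Isomorphism of unital dimension groups preserves order and order unit. The action $\lambda$: if $T$ is the homeomorphism of order $2$ commuting with $\phi$, then $\lambda_a(x,n)=(Tx,n)$ for the nontrivial $a\in\mathbb Z/2$. $\mathcal G\rtimes_\lambda\mathbb Z/2$ is $\mathcal G\times\mathbb Z/2$ with the product topology, unit space identified with $X$, $r(g,a)=r(g)$, $s(g,a)=\lambda_a^{-1}(s(g))$, $(g,a)(h,b)=(g\lambda_a(h),a+b)$. $\mathcal G$ is identified with $\mathcal G\times\{0\}\subset\mathcal H$. A bisection is a subset on which $r$ and $s$ are injective; a full bisection is a compact open bisection $U$ with $r(U)=s(U)$ equal to the unit space; $\theta_U:=r\circ(s|_U)^{-1}$. $\mathsf F(\mathcal G)$ is the group of all homeomorphisms $\theta_U$ of the unit space and $\mathsf D(\mathcal G)$ its commutator subgroup; $\mathsf F(\mathcal G)\subset\mathsf F(\mathcal H)$, $\mathsf D(\mathcal G)\subset\mathsf D(\mathcal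 H)$. The restriction of $\lambda_a$ to $X$ is an element of $\mathsf F(\mathcal H)$, again written $\lambda_a$. In this situation an element $\beta$ as in the claim exists, $M$ is a subgroup of $\mathsf D(\mathcal H)$ independent of the choice of $\beta$, and $\mathsf D(\mathcal G)$ is normal of index $2$ in $M$ (proved in the paper before this statement). *)

theory Defs
  imports "HOL-Analysis.Analysis" "HOL-Algebra.Bij" "HOL-Algebra.Elementary_Groups"
begin

section \<open>Dimension groups\<close>

text \<open>
  Abelian groups are written multiplicatively, as in HOL-Algebra: the paper's $nx$ is
  \<^term>\<open>x [^]\<^bsub>D\<^esub> n\<close>. The order of a group \<open>D\<close> with positive cone \<open>P\<close> is
  $x \le y$ iff $y - x \in P$.
\<close>

definition cone_le :: "('d, 'm) monoid_scheme \<Rightarrow> 'd set \<Rightarrow> 'd \<Rightarrow> 'd \<Rightarrow> bool" where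
  "cone_le D P x y \<longleftrightarrow> y \<otimes>\<^bsub>D\<^esub> inv\<^bsub>D\<^esub> x \<in> P"

definition ordered_abelian_group :: "('d, 'm) monoid_scheme \<Rightarrow> 'd set \<Rightarrow> bool" where
  "ordered_abelian_group D P \<longleftrightarrow>
     comm_group D \<and> P \<subseteq> carrier D \<and> \<one>\<^bsub>D\<^esub> \<in> P \<and>
     (\<forall>x\<in>P. \<forall>y\<in>P. x \<otimes>\<^bsub>D\<^esub> y \<in> P) \<and>
     (\<forall>x\<in>P. inv\<^bsub>D\<^esub> x \<in> P \<longrightarrow> x = \<one>\<^bsub>D\<^esub>)"

definition directed_cone :: "('d, 'm) monoid_scheme \<Rightarrow> 'd set \<Rightarrow> bool" where
  "directed_cone D P \<longleftrightarrow>
     (\<forall>x\<in>carrier D. \<forall>y\<in>carrier D. \<exists>z\<in>carrier D. cone_le D P x z \<and> cone_le D P y z)"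

definition unperforated :: "('d, 'm) monoid_scheme \<Rightarrow> 'd set \<Rightarrow> bool" where
  "unperforated D P \<longleftrightarrow>
     (\<forall>x\<in>carrier D. \<forall>n::nat. n \<ge> 1 \<longrightarrow> x [^]\<^bsub>D\<^esub> n \<in> P \<longrightarrow> x \<in> P)"

definition riesz_interpolation :: "('d, 'm) monoid_scheme \<Rightarrow> 'd set \<Rightarrow> bool" where
  "riesz_interpolation D P \<longleftrightarrow>
     (\<forall>x1\<in>carrier D. \<forall>x2\<in>carrier D. \<forall>y1\<in>carrier D. \<forall>y2\<in>carrier D.
        cone_le D P x1 y1 \<and> cone_le D P x1 y2 \<and> cone_le D P x2 y1 \<and> cone_le D P x2 y2 \<longrightarrow>
        (\<exists>z\<in>carrier D. cone_le D P x1 z \<and> cone_le D P x2 z \<and>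
                        cone_le D P z y1 \<and> cone_le D P z y2))"

definition is_order_unit :: "('d, 'm) monoid_scheme \<Rightarrow> 'd set \<Rightarrow> 'd \<Rightarrow> bool" where
  "is_order_unit D P u \<longleftrightarrow>
     u \<in> P \<and> (\<forall>x\<in>carrier D. \<exists>n::nat. cone_le D P x (u [^]\<^bsub>D\<^esub> n))"

definition unital_dimension_group :: "('d, 'm) monoid_scheme \<Rightarrow> 'd set \<Rightarrow> 'd \<Rightarrow> bool" where
  "unital_dimension_group D P u \<longleftrightarrow>
     ordered_abelian_group D P \<and> countable (carrier D) \<and> directed_cone D P \<and>
     unperforated D P \<and> riesz_interpolation D P \<and> is_order_unit D P u"

definition simple_cone :: "('d, 'm) monoid_scheme \<Rightarrow> 'd set \<Rightarrow> bool" where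
  "simple_cone D P \<longleftrightarrow> (\<forall>x\<in>P. x \<noteq> \<one>\<^bsub>D\<^esub> \<longrightarrow> is_order_unit D P x)"

definition ordered_iso ::
  "('d, 'm) monoid_scheme \<Rightarrow> 'd set \<Rightarrow> ('e, 'n) monoid_scheme \<Rightarrow> 'e set \<Rightarrow> bool" where
  "ordered_iso D P E Q \<longleftrightarrow> (\<exists>h\<in>iso D E. h ` P = Q)"

definition unital_ordered_iso ::
  "('d, 'm) monoid_scheme \<Rightarrow> 'd set \<Rightarrow> 'd \<Rightarrow> ('e, 'n) monoid_scheme \<Rightarrow> 'e set \<Rightarrow> 'e \<Rightarrow> bool" where
  "unital_ordered_iso D P u E Q v \<longleftrightarrow> (\<exists>h\<in>iso D E. h ` P = Q \<and> h u = v)"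

definition multiples :: "nat \<Rightarrow> ('d, 'm) monoid_scheme \<Rightarrow> 'd set" where
  "multiples n D = {x [^]\<^bsub>D\<^esub> n | x. x \<in> carrier D}"


section \<open>Homeomorphisms of a Cantor set\<close>

definition cantor_space :: "'x topology \<Rightarrow> bool" where
  "cantor_space X \<longleftrightarrow>
     X homeomorphic_space
       product_topology (\<lambda>_::nat. discrete_topology (UNIV :: bool set)) UNIV"

text \<open>
  Homeomorphisms of \<open>X\<close> are elements of \<^term>\<open>BijGroup (topspace X)\<close>; in particular they are
  extensional functions (equal to \<^term>\<open>undefined\<close> off \<^term>\<open>topspace X\<close>).
\<close>

definition homeos :: "'x topology \<Rightarrow> ('x \<Rightarrow> 'x) set" where
  "homeos X = {f \<in> carrier (BijGroup (topspace X)). homeomorphic_map X X f}"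

definition minimal_homeo :: "'x topology \<Rightarrow> ('x \<Rightarrow> 'x) \<Rightarrow> bool" where
  "minimal_homeo X \<phi> \<longleftrightarrow>
     (\<forall>x\<in>topspace X.
        Abstract_Topology.closure_of X {(\<phi> [^]\<^bsub>BijGroup (topspace X)\<^esub> n) x | n::int. True} =
          topspace X)"


section \<open>Topological groupoids and full groups\<close>

text \<open>
  The unit space is a space of its own, embedded into the arrows by \<open>unit_arrow\<close>.
  The product \<open>gcomp g h\<close> is meaningful if \<open>source_map g = range_map h\<close>.
\<close>

record ('g, 'x) top_groupoid =
  arrows :: "'g topology"
  units :: "'x topology"
  range_map :: "'g \<Rightarrow> 'x"
  source_map :: "'g \<Rightarrow> 'x"
  unit_arrow :: "'x \<Rightarrow> 'g"
  gcomp :: "'g \<Rightarrow> 'g \<Rightarrow> 'g"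

definition transformation_groupoid ::
  "'x topology \<Rightarrow> ('x \<Rightarrow> 'x) \<Rightarrow> ('x \<times> int, 'x) top_groupoid" where
  "transformation_groupoid X \<phi> =
     \<lparr> arrows = prod_topology X (discrete_topology UNIV),
       units = X,
       range_map = (\<lambda>(x, n). x),
       source_map = (\<lambda>(x, n). (\<phi> [^]\<^bsub>BijGroup (topspace X)\<^esub> (- n)) x),
       unit_arrow = (\<lambda>x. (x, 0)),
       gcomp = (\<lambda>(x, n) (y, m). (x, n + m)) \<rparr>"

text \<open>The homeomorphism of the unit space induced by a groupoid automorphism.\<close>

definition on_units :: "('g, 'x) top_groupoid \<Rightarrow> ('g \<Rightarrow> 'g) \<Rightarrow> 'x \<Rightarrow> 'x" where
  "on_units G \<alpha> = (\<lambda>x\<in>topspace (units G). range_map G (\<alpha> (unit_arrow G x)))"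

text \<open>
  The semidirect product by an action \<open>lam\<close> of a discrete group; in the source map,
  $\lambda_a^{-1}$ is written as $\lambda_{a^{-1}}$.
\<close>

definition semidirect_groupoid ::
  "('g, 'x) top_groupoid \<Rightarrow> 'a monoid \<Rightarrow> ('a \<Rightarrow> 'g \<Rightarrow> 'g) \<Rightarrow> ('g \<times> 'a, 'x) top_groupoid" where
  "semidirect_groupoid G \<Gamma> lam =
     \<lparr> arrows = prod_topology (arrows G) (discrete_topology (carrier \<Gamma>)),
       units = units G,
       range_map = (\<lambda>(g, a). range_map G g),
       source_map = (\<lambda>(g, a). on_units G (lam (inv\<^bsub>\<Gamma>\<^esub> a)) (source_map G g)),
       unit_arrow = (\<lambda>x. (unit_arrow G x, \<one>\<^bsub>\<Gamma>\<^esub>)),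
       gcomp = (\<lambda>(g, a) (h, b). (gcomp G g (lam a h), a \<otimes>\<^bsub>\<Gamma>\<^esub> b)) \<rparr>"

definition full_bisection :: "('g, 'x) top_groupoid \<Rightarrow> 'g set \<Rightarrow> bool" where
  "full_bisection G U \<longleftrightarrow>
     compactin (arrows G) U \<and> openin (arrows G) U \<and>
     inj_on (range_map G) U \<and> inj_on (source_map G) U \<and>
     range_map G ` U = topspace (units G) \<and> source_map G ` U = topspace (units G)"

definition bisection_homeo :: "('g, 'x) top_groupoid \<Rightarrow> 'g set \<Rightarrow> 'x \<Rightarrow> 'x" where
  "bisection_homeo G U =
     (\<lambda>x\<in>topspace (units G). range_map G (inv_into U (source_map G) x))"

definition topological_full_group :: "('g, 'x) top_groupoid \<Rightarrow> ('x \<Rightarrow> 'x) set" where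
  "topological_full_group G = {bisection_homeo G U | U. full_bisection G U}"

definition derived_full_group :: "('g, 'x) top_groupoid \<Rightarrow> ('x \<Rightarrow> 'x) set" where
  "derived_full_group G =
     derived (BijGroup (topspace (units G))) (topological_full_group G)"


section \<open>The ordered group $H_0$ of a transformation groupoid\<close>

definition integer_functions :: "'x topology \<Rightarrow> ('x \<Rightarrow> int) monoid" where
  "integer_functions X =
     \<lparr> carrier = {f \<in> extensional (topspace X). continuous_map X (discrete_topology UNIV) f},
       monoid.mult = (\<lambda>f g. \<lambda>x\<in>topspace X. f x + g x),
       one = (\<lambda>x\<in>topspace X. 0) \<rparr>"

definition coboundaries :: "'x topology \<Rightarrow> ('x \<Rightarrow> 'x) \<Rightarrow> ('x \<Rightarrow> int) set" where
  "coboundaries X \<phi> =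
     {(\<lambda>x\<in>topspace X. f (\<phi> x) - f x) | f. f \<in> carrier (integer_functions X)}"

definition H0_class :: "'x topology \<Rightarrow> ('x \<Rightarrow> 'x) \<Rightarrow> ('x \<Rightarrow> int) \<Rightarrow> ('x \<Rightarrow> int) set" where
  "H0_class X \<phi> f = coboundaries X \<phi> #>\<^bsub>integer_functions X\<^esub> f"

definition H0 :: "'x topology \<Rightarrow> ('x \<Rightarrow> 'x) \<Rightarrow> ('x \<Rightarrow> int) set monoid" where
  "H0 X \<phi> = integer_functions X Mod coboundaries X \<phi>"

definition H0_cone :: "'x topology \<Rightarrow> ('x \<Rightarrow> 'x) \<Rightarrow> ('x \<Rightarrow> int) set set" where
  "H0_cone X \<phi> =
     {H0_class X \<phi> f | f. f \<in> carrier (integer_functions X) \<and> (\<forall>x\<in>topspace X. f x \<ge> 0)}"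

definition H0_unit :: "'x topology \<Rightarrow> ('x \<Rightarrow> 'x) \<Rightarrow> ('x \<Rightarrow> int) set" where
  "H0_unit X \<phi> = H0_class X \<phi> (\<lambda>x\<in>topspace X. 1)"

text \<open>
  A homeomorphism \<open>t\<close> of \<open>X\<close> coming from an automorphism of the groupoid sends $[f]$ to
  $[f \circ t^{-1}]$; on classes, which are sets of functions, this is the image.
\<close>

definition H0_map :: "'x topology \<Rightarrow> ('x \<Rightarrow> 'x) \<Rightarrow> ('x \<Rightarrow> int) set \<Rightarrow> ('x \<Rightarrow> int) set" where
  "H0_map X t c = (\<lambda>f. \<lambda>x\<in>topspace X. f (inv_into (topspace X) t x)) ` c"


section \<open>The action and the extension\<close>

text \<open>\<^term>\<open>integer_mod_group 2\<close> has carrier $\{0, 1\}$, so the nontrivial element is 1.\<close>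

definition Z2_action :: "'x topology \<Rightarrow> ('x \<Rightarrow> 'x) \<Rightarrow> int \<Rightarrow> 'x \<times> int \<Rightarrow> 'x \<times> int" where
  "Z2_action X T a = (\<lambda>(x, n). ((T [^]\<^bsub>BijGroup (topspace X)\<^esub> a) x, n))"

text \<open>
  For an extension $1 \to N \to E \to Q \to 1$ with quotient map \<open>p\<close>: it splits if \<open>p\<close> has a
  homomorphic section.
\<close>

definition extension_splits ::
  "('e, 'm) monoid_scheme \<Rightarrow> ('e \<Rightarrow> 'q) \<Rightarrow> ('q, 'n) monoid_scheme \<Rightarrow> bool" where
  "extension_splits E p Q \<longleftrightarrow> (\<exists>\<sigma>\<in>hom Q E. \<forall>q\<in>carrier Q. p (\<sigma> q) = q)"

end

theory Submission
  imports Defs "HOL-Library.Z2"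
begin

text \<open>
  A splitting gives an involution \<open>\<tau>\<close> in \<open>M\<close> outside \<open>D(\<G>)\<close>. It moves every point, because it
  agrees on each \<open>\<phi>\<close>-orbit with some \<open>\<phi>\<^sup>n T\<close> and the group generated by \<open>\<phi>\<close> and \<open>T\<close> acts freely.
  Orient each pair of distinct points in an orbit of that group, by the sign of the power of \<open>\<phi>\<close>
  and, for the pairs \<open>{x, T x}\<close>, by a clopen fundamental domain of \<open>T\<close>. For \<open>g\<close> in the full group of
  \<open>\<H>\<close>, the number of pairs at \<open>x\<close> whose orientation \<open>g\<close> reverses is a continuous function of
  \<open>x\<close>. As for the sign of a permutation, its class in \<open>H\<^sub>0/2H\<^sub>0\<close> is a homomorphism in \<open>g\<close>; the
  bookkeeping of pairs is the mass transport principle, that \<open>#{y. P x y}\<close> and \<open>#{y. P y x}\<close> define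
  the same class. So it vanishes on \<open>\<tau>\<close>, an element of \<open>D(\<H>)\<close>. For a free involution the class is
  that of the clopen set \<open>Y = {x. x precedes \<tau> x}\<close>, whose complement is \<open>\<tau> Y\<close>. Hence \<open>[Y] \<in> 2D\<close>
  and \<open>u = [Y] + [\<tau> Y] = 2[Y] \<in> 4D\<close>.
\<close>

section \<open>Clopen predicates and integer-valued functions\<close>

text \<open>No orientation of the orbits is invariant: \<open>T\<close> exchanges \<open>x\<close>
  and \<open>T x\<close> and so reverses that pair. What is asked instead is that the orientation
  changes only at finitely many displacements under given translations; as an element of a full
  group uses finitely many translations, its count is finite. Over the integers the count is not a
  homomorphism: its defect on \<open>g\<close> and \<open>h\<close> is, up to coboundaries, minus
  twice a count of pairs. So the sign lives modulo two. The factor four needs two quotients. The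
  sign shows that \<open>Y\<close> is twice a function \<open>d\<close> up to a coboundary; that
  \<open>Y\<close> and its translate by \<tau> have the same class must hold in H_0 itself, since
  knowing it modulo two would not give 1 = 4 d. The arguments on counts are therefore made over an
  abstract \<open>Null\<close>, instantiated once with each. Coboundaries are taken along \<phi>
  only. The triviality of the action on H_0 makes them absorb translations by \<open>T\<close>, so
  that classes are invariant under the full group of \<H>.\<close>

definition clopen_pred :: "'x topology \<Rightarrow> ('x \<Rightarrow> bool) \<Rightarrow> bool" where
  "clopen_pred X p \<longleftrightarrow>
     openin X {x \<in> topspace X. p x} \<and> openin X {x \<in> topspace X. \<not> p x}"

lemma clopen_pred_cong:
  assumes "clopen_pred X p" "\<And>x. x \<in> topspace X \<Longrightarrow> p x \<longleftrightarrow> q x"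
  shows "clopen_pred X q"
proof -
  have "{x \<in> topspace X. q x} = {x \<in> topspace X. p x}"
    "{x \<in> topspace X. \<not> q x} = {x \<in> topspace X. \<not> p x}"
    using assms(2) by auto
  then show ?thesis using assms(1) by (simp add: clopen_pred_def)
qed

lemma clopen_pred_const: "clopen_pred X (\<lambda>_. c)"
  by (cases c) (simp_all add: clopen_pred_def)

lemma clopen_pred_not: "clopen_pred X p \<Longrightarrow> clopen_pred X (\<lambda>x. \<not> p x)"
  by (simp add: clopen_pred_def)

lemma clopen_pred_conj:
  assumes "clopen_pred X p" "clopen_pred X q"
  shows "clopen_pred X (\<lambda>x. p x \<and> q x)"
proof -
  have "{x \<in> topspace X. p x \<and> q x} = {x \<in> topspace X. p x} \<inter> {x \<in> topspace X. q x}"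
    "{x \<in> topspace X. \<not> (p x \<and> q x)} = {x \<in> topspace X. \<not> p x} \<union> {x \<in> topspace X. \<not> q x}"
    by auto
  then show ?thesis using assms unfolding clopen_pred_def by (simp add: openin_Int openin_Un)
qed

lemma clopen_pred_disj:
  assumes "clopen_pred X p" "clopen_pred X q"
  shows "clopen_pred X (\<lambda>x. p x \<or> q x)"
  using clopen_pred_not[OF clopen_pred_conj[OF clopen_pred_not[OF assms(1)] clopen_pred_not[OF assms(2)]]]
  by simp

lemma clopen_pred_bex:
  assumes "finite N" "\<And>i. i \<in> N \<Longrightarrow> clopen_pred X (p i)"
  shows "clopen_pred X (\<lambda>x. \<exists>i\<in>N. p i x)"
  using assms by (induction N) (simp_all add: clopen_pred_const clopen_pred_disj)

lemma clopen_pred_compose: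
  assumes "clopen_pred X p" "continuous_map Y X f"
  shows "clopen_pred Y (\<lambda>y. p (f y))"
proof -
  have *: "openin Y {y \<in> topspace Y. q (f y)}" if "openin X {x \<in> topspace X. q x}" for q
  proof -
    have "f y \<in> topspace X" if "y \<in> topspace Y" for y
      using that assms(2) by (auto simp: continuous_map_def)
    then have "{y \<in> topspace Y. q (f y)} = {y \<in> topspace Y. f y \<in> {x \<in> topspace X. q x}}"
      by auto
    then show ?thesis using openin_continuous_map_preimage[OF assms(2) that] by (simp only:)
  qed
  show ?thesis
    using assms(1) *[of p] *[of "\<lambda>x. \<not> p x"] by (simp add: clopen_pred_def)
qed

lemma continuous_map_discrete_iff:
  "continuous_map X (discrete_topology UNIV) f \<longleftrightarrow> (\<forall>n. openin X {x \<in> topspace X. f x = n})"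
proof
  assume "continuous_map X (discrete_topology UNIV) f"
  then show "\<forall>n. openin X {x \<in> topspace X. f x = n}"
    using openin_continuous_map_preimage[of X "discrete_topology UNIV" f "{n}" for n] by simp
next
  assume *: "\<forall>n. openin X {x \<in> topspace X. f x = n}"
  have "openin X {x \<in> topspace X. f x \<in> U}" for U
  proof -
    have "{x \<in> topspace X. f x \<in> U} = (\<Union>n\<in>U. {x \<in> topspace X. f x = n})" by auto
    then show ?thesis using * by auto
  qed
  then show "continuous_map X (discrete_topology UNIV) f" by (simp add: continuous_map_def)
qed

abbreviation locally_constant :: "'x topology \<Rightarrow> ('x \<Rightarrow> 'b) \<Rightarrow> bool" where
  "locally_constant X \<equiv> continuous_map X (discrete_topology UNIV)"

lemma clopen_pred_locally_constant:
  assumes "locally_constant X f" shows "clopen_pred X (\<lambda>x. P (f x))"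
  using openin_continuous_map_preimage[OF assms, of "Collect P"]
    openin_continuous_map_preimage[OF assms, of "{b. \<not> P b}"]
  by (simp add: clopen_pred_def)

lemma locally_constant_combine:
  assumes "locally_constant X f" "locally_constant X g"
  shows "locally_constant X (\<lambda>x. F (f x) (g x))"
  unfolding continuous_map_discrete_iff
proof
  fix n
  have "{x \<in> topspace X. F (f x) (g x) = n} =
     (\<Union>(a, b)\<in>{(a, b). F a b = n}. {x \<in> topspace X. f x = a} \<inter> {x \<in> topspace X. g x = b})"
    by auto
  also have "openin X \<dots>"
    using assms unfolding continuous_map_discrete_iff by (auto intro!: openin_Union openin_Int)
  finally show "openin X {x \<in> topspace X. F (f x) (g x) = n}" .
qed

lemma locally_constant_of_bool:
  assumes "clopen_pred X p"
  shows "locally_constant X (\<lambda>x. of_bool (p x) :: int)"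
  unfolding continuous_map_discrete_iff
proof
  fix n :: int
  have "{x \<in> topspace X. of_bool (p x) = n} =
     (if n = 0 then {x \<in> topspace X. \<not> p x} else if n = 1 then {x \<in> topspace X. p x} else {})"
    by auto
  then show "openin X {x \<in> topspace X. of_bool (p x) = n}"
    using assms by (simp add: clopen_pred_def)
qed

lemma locally_constant_sum:
  fixes f :: "'i \<Rightarrow> 'x \<Rightarrow> int"
  assumes "finite N" "\<And>i. i \<in> N \<Longrightarrow> locally_constant X (f i)"
  shows "locally_constant X (\<lambda>x. \<Sum>i\<in>N. f i x)"
  using assms
  by (induction N) (simp_all add: locally_constant_combine[where F = "(+)"])

section \<open>Mass transport\<close>

locale free_action =
  fixes X :: "'x topology" and act :: "'i::group_add \<Rightarrow> 'x \<Rightarrow> 'x"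
  assumes act_cont: "continuous_map X X (act \<gamma>)"
    and act_add: "x \<in> topspace X \<Longrightarrow> act (\<gamma> + \<delta>) x = act \<gamma> (act \<delta> x)"
    and act_zero: "x \<in> topspace X \<Longrightarrow> act 0 x = x"
    and act_free: "x \<in> topspace X \<Longrightarrow> act \<gamma> x = x \<Longrightarrow> \<gamma> = 0"
begin

lemma act_in: "x \<in> topspace X \<Longrightarrow> act \<gamma> x \<in> topspace X"
  using act_cont[of \<gamma>] by (auto simp: continuous_map_def)

lemma act_minus_act: "x \<in> topspace X \<Longrightarrow> act (- \<gamma>) (act \<gamma> x) = x"
  by (metis act_add act_zero left_minus)

lemma act_act_minus: "x \<in> topspace X \<Longrightarrow> act \<gamma> (act (- \<gamma>) x) = x"
  by (metis act_add act_zero right_minus)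

lemma act_eq_iff: "x \<in> topspace X \<Longrightarrow> act \<gamma> x = act \<delta> x \<longleftrightarrow> \<gamma> = \<delta>"
proof
  assume x: "x \<in> topspace X" and eq: "act \<gamma> x = act \<delta> x"
  then have "act (- \<delta> + \<gamma>) x = x" by (simp add: act_add act_minus_act)
  then have "- \<delta> + \<gamma> = 0" using act_free x by blast
  then show "\<gamma> = \<delta>" by (metis add.inverse_inverse minus_unique)
qed simp

text \<open>A relation on orbits is read as a subset of the transformation groupoid of the action:
  \<open>kernel\<close> says that it is clopen there, and \<open>supported\<close> bounds the
  displacements. For compact \<open>X\<close>, \<open>finite_kernel\<close> thus describes compact
  open subsets, and \<open>cnt\<close> counts their fibres.\<close>

definition kernel :: "('x \<Rightarrow> 'x \<Rightarrow> bool) \<Rightarrow> bool" where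
  "kernel P \<longleftrightarrow> (\<forall>\<gamma>. clopen_pred X (\<lambda>x. P x (act \<gamma> x)))"

definition supported :: "'i set \<Rightarrow> ('x \<Rightarrow> 'x \<Rightarrow> bool) \<Rightarrow> bool" where
  "supported N P \<longleftrightarrow> finite N \<and>
     (\<forall>x\<in>topspace X. \<forall>y\<in>topspace X. P x y \<longrightarrow> (\<exists>\<gamma>\<in>N. y = act \<gamma> x))"

definition finite_kernel :: "('x \<Rightarrow> 'x \<Rightarrow> bool) \<Rightarrow> bool" where
  "finite_kernel P \<longleftrightarrow> kernel P \<and> (\<exists>N. supported N P)"

text \<open>For infinitely many targets \<open>card\<close> returns 0; \<open>finite_targets\<close>
  excludes that case for a \<open>finite_kernel\<close>.\<close>

definition cnt :: "('x \<Rightarrow> 'x \<Rightarrow> bool) \<Rightarrow> 'x \<Rightarrow> int" where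
  "cnt P x = int (card {y \<in> topspace X. P x y})"

lemma kernel_not: "kernel P \<Longrightarrow> kernel (\<lambda>x y. \<not> P x y)"
  by (simp add: kernel_def clopen_pred_not)

lemma kernel_conj: "kernel P \<Longrightarrow> kernel Q \<Longrightarrow> kernel (\<lambda>x y. P x y \<and> Q x y)"
  by (simp add: kernel_def clopen_pred_conj)

lemma kernel_swap: assumes "kernel P" shows "kernel (\<lambda>x y. P y x)"
  unfolding kernel_def
proof
  fix \<gamma>
  have "clopen_pred X (\<lambda>x. P (act \<gamma> x) (act (- \<gamma>) (act \<gamma> x)))"
    using assms clopen_pred_compose[OF _ act_cont] unfolding kernel_def by blast
  then show "clopen_pred X (\<lambda>x. P (act \<gamma> x) x)"
    by (rule clopen_pred_cong) (simp add: act_minus_act)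
qed

lemma finite_kernel_conj: "finite_kernel P \<Longrightarrow> kernel Q \<Longrightarrow> finite_kernel (\<lambda>x y. P x y \<and> Q x y)"
  unfolding finite_kernel_def supported_def by (simp add: kernel_conj) blast

lemma supported_swap:
  assumes N: "supported N P" shows "supported (uminus ` N) (\<lambda>x y. P y x)"
  unfolding supported_def
proof (intro conjI ballI impI)
  show "finite (uminus ` N)" using N by (simp add: supported_def)
  fix x y assume "x \<in> topspace X" "y \<in> topspace X" "P y x"
  then obtain \<gamma> where "\<gamma> \<in> N" "x = act \<gamma> y" using N by (auto simp: supported_def)
  then show "\<exists>\<gamma>\<in>uminus ` N. y = act \<gamma> x"
    using act_minus_act[OF \<open>y \<in> topspace X\<close>] by (metis imageI)
qed

lemma finite_kernel_swap: "finite_kernel P \<Longrightarrow> finite_kernel (\<lambda>x y. P y x)"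
  unfolding finite_kernel_def using kernel_swap supported_swap by blast

lemma support_set:
  assumes "supported N P" "x \<in> topspace X"
  shows "{y \<in> topspace X. P x y} = (\<lambda>\<gamma>. act \<gamma> x) ` {\<gamma> \<in> N. P x (act \<gamma> x)}"
  using assms act_in unfolding supported_def by fastforce

lemma finite_targets:
  assumes "finite_kernel P" "x \<in> topspace X"
  shows "finite {y \<in> topspace X. P x y}"
proof -
  obtain N where "supported N P" using assms by (auto simp: finite_kernel_def)
  then show ?thesis using support_set[OF _ assms(2)] by (simp add: supported_def)
qed

text \<open>By freeness different displacements lead to different targets, so targets can be counted
  by displacement. In this form \<open>cnt\<close> is visibly locally constant and can be translated
  term by term.\<close>

lemma cnt_eq_sum:
  assumes "supported N P" "x \<in> topspace X"
  shows "cnt P x = (\<Sum>\<gamma>\<in>N. of_bool (P x (act \<gamma> x)))"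
proof -
  have "inj_on (\<lambda>\<gamma>. act \<gamma> x) {\<gamma> \<in> N. P x (act \<gamma> x)}"
    using act_eq_iff assms(2) by (auto simp: inj_on_def)
  then have "cnt P x = int (card {\<gamma> \<in> N. P x (act \<gamma> x)})"
    unfolding cnt_def support_set[OF assms] by (simp add: card_image)
  also have "\<dots> = (\<Sum>\<gamma>\<in>N. of_bool (P x (act \<gamma> x)))"
    using assms(1) by (simp add: supported_def Int_def)
  finally show ?thesis .
qed

lemma cnt_locally_constant:
  assumes "finite_kernel P" shows "locally_constant X (cnt P)"
proof -
  obtain N where N: "supported N P" using assms by (auto simp: finite_kernel_def)
  have "locally_constant X (\<lambda>x. \<Sum>\<gamma>\<in>N. of_bool (P x (act \<gamma> x)) :: int)"
    using assms N by (intro locally_constant_sum locally_constant_of_bool)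
      (auto simp: supported_def finite_kernel_def kernel_def)
  then show ?thesis
    by (rule continuous_map_eq) (simp add: cnt_eq_sum[OF N])
qed

lemma cnt_split:
  assumes "finite_kernel P" "x \<in> topspace X"
  shows "cnt P x = cnt (\<lambda>x y. P x y \<and> S x y) x + cnt (\<lambda>x y. P x y \<and> \<not> S x y) x"
proof -
  have fin: "finite {y \<in> topspace X. P x y}" using finite_targets assms by blast
  have "{y \<in> topspace X. P x y} =
      {y \<in> topspace X. P x y \<and> S x y} \<union> {y \<in> topspace X. P x y \<and> \<not> S x y}" by auto
  moreover have "card ({y \<in> topspace X. P x y \<and> S x y} \<union> {y \<in> topspace X. P x y \<and> \<not> S x y}) =
      card {y \<in> topspace X. P x y \<and> S x y} + card {y \<in> topspace X. P x y \<and> \<not> S x y}"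
    by (rule card_Un_disjoint) (auto intro: finite_subset[OF _ fin])
  ultimately show ?thesis by (simp add: cnt_def)
qed

lemma cnt_cong:
  assumes "\<And>y. y \<in> topspace X \<Longrightarrow> P x y \<longleftrightarrow> Q x y" shows "cnt P x = cnt Q x"
  unfolding cnt_def using assms by (metis (mono_tags, lifting) Collect_cong)

text \<open>Change of variable in the target. The base point may change too, independently of
  \<open>h\<close>, so pairs at \<open>x\<close> can be matched with transposed pairs at its
  image.\<close>

lemma cnt_reindex:
  assumes "bij_betw h (topspace X) (topspace X)"
    and "\<And>y. y \<in> topspace X \<Longrightarrow> P x y \<longleftrightarrow> Q x' (h y)"
  shows "cnt P x = cnt Q x'"
proof -
  have "h ` {y \<in> topspace X. P x y} = {y \<in> topspace X. Q x' y}"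
  proof (intro equalityI subsetI)
    fix z assume "z \<in> {y \<in> topspace X. Q x' y}"
    moreover from this obtain y where "y \<in> topspace X" "z = h y"
      using assms(1) by (auto simp: bij_betw_def)
    ultimately show "z \<in> h ` {y \<in> topspace X. P x y}" using assms(2) by auto
  qed (use assms in \<open>auto simp: bij_betw_def\<close>)
  moreover have "card (h ` {y \<in> topspace X. P x y}) = card {y \<in> topspace X. P x y}"
    using assms(1) by (intro card_image) (auto simp: bij_betw_def inj_on_def)
  ultimately show ?thesis by (simp only: cnt_def)
qed

text \<open>Elements of the topological full group, with displacements confined to \<open>C\<close>.\<close>

definition full_on :: "'i set \<Rightarrow> ('x \<Rightarrow> 'x) \<Rightarrow> bool" where
  "full_on C g \<longleftrightarrow> bij_betw g (topspace X) (topspace X) \<and>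
     (\<exists>N\<subseteq>C. finite N \<and> (\<forall>x\<in>topspace X. \<exists>\<gamma>\<in>N. g x = act \<gamma> x)) \<and>
     (\<forall>\<gamma>. clopen_pred X (\<lambda>x. g x = act \<gamma> x))"

abbreviation "full \<equiv> full_on UNIV"

lemma full_on_mono: "full_on C g \<Longrightarrow> full g"
  unfolding full_on_def by blast

lemma full_on_bij: "full_on C g \<Longrightarrow> bij_betw g (topspace X) (topspace X)"
  by (simp add: full_on_def)

lemma full_on_in: "full_on C g \<Longrightarrow> x \<in> topspace X \<Longrightarrow> g x \<in> topspace X"
  by (auto simp: full_on_def bij_betw_def)

lemma full_on_inj: "full_on C g \<Longrightarrow> x \<in> topspace X \<Longrightarrow> y \<in> topspace X \<Longrightarrow> g x = g y \<longleftrightarrow> x = y"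
  by (auto simp: full_on_def bij_betw_def inj_on_def)

lemma full_on_obtain:
  assumes "full_on C g"
  obtains N where "N \<subseteq> C" "finite N" "\<And>x. x \<in> topspace X \<Longrightarrow> \<exists>\<gamma>\<in>N. g x = act \<gamma> x"
  using assms unfolding full_on_def by blast

lemma full_on_clopen: "full_on C g \<Longrightarrow> clopen_pred X (\<lambda>x. g x = act \<gamma> x)"
  by (simp add: full_on_def)

lemma full_on_cong:
  assumes "full_on C g" "\<And>x. x \<in> topspace X \<Longrightarrow> g x = h x"
  shows "full_on C h"
  unfolding full_on_def
proof (intro conjI allI)
  show "bij_betw h (topspace X) (topspace X)"
    using full_on_bij[OF assms(1)] bij_betw_cong[of "topspace X" g h] assms(2) by simp
  show "\<exists>N\<subseteq>C. finite N \<and> (\<forall>x\<in>topspace X. \<exists>\<gamma>\<in>N. h x = act \<gamma> x)"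
    by (rule full_on_obtain[OF assms(1)]) (metis assms(2))
  show "clopen_pred X (\<lambda>x. h x = act \<gamma> x)" for \<gamma>
    by (rule clopen_pred_cong[OF full_on_clopen[OF assms(1)]]) (simp add: assms(2))
qed

lemma full_on_act:
  assumes "\<gamma> \<in> C" shows "full_on C (act \<gamma>)"
  unfolding full_on_def
proof (intro conjI allI)
  show "bij_betw (act \<gamma>) (topspace X) (topspace X)"
    by (rule bij_betw_byWitness[where f' = "act (- \<gamma>)"])
       (auto simp: act_minus_act act_act_minus act_in)
  show "\<exists>N\<subseteq>C. finite N \<and> (\<forall>x\<in>topspace X. \<exists>\<delta>\<in>N. act \<gamma> x = act \<delta> x)"
    using assms by (intro exI[of _ "{\<gamma>}"]) auto
  show "clopen_pred X (\<lambda>x. act \<gamma> x = act \<delta> x)" for \<delta>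
    by (rule clopen_pred_cong[OF clopen_pred_const[of X "\<gamma> = \<delta>"]]) (simp add: act_eq_iff)
qed

lemma full_id: "full (\<lambda>x. x)"
  by (rule full_on_cong[OF full_on_act[of 0]]) (simp_all add: act_zero)

text \<open>Where \<open>g\<close> moves \<open>x\<close> by \<alpha> and \<open>h\<close> moves
  \<open>act \<gamma> x\<close> by \<beta>, the new pair has displacement \<beta> + \<gamma> -
  \<alpha> seen from \<open>act \<alpha> x\<close>. Finitely many \<alpha> and \<beta> occur, so the
  condition is a finite union of clopen ones.\<close>

lemma kernel_subst:
  assumes "kernel P" "full g" "full h"
  shows "kernel (\<lambda>x y. P (g x) (h y))"
  unfolding kernel_def
proof
  fix \<gamma>
  obtain N where N: "finite N" "\<And>x. x \<in> topspace X \<Longrightarrow> \<exists>\<gamma>\<in>N. g x = act \<gamma> x"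
    by (rule full_on_obtain[OF assms(2)]) (rule that)
  obtain N' where N': "finite N'" "\<And>x. x \<in> topspace X \<Longrightarrow> \<exists>\<gamma>\<in>N'. h x = act \<gamma> x"
    by (rule full_on_obtain[OF assms(3)]) (rule that)
  have *: "clopen_pred X (\<lambda>x. P (act \<alpha> x) (act (\<beta> + \<gamma> - \<alpha>) (act \<alpha> x)))" for \<alpha> \<beta>
    using assms(1) clopen_pred_compose[OF _ act_cont] unfolding kernel_def by blast
  have **: "clopen_pred X (\<lambda>x. h (act \<gamma> x) = act \<beta> (act \<gamma> x))" for \<beta>
    using clopen_pred_compose[OF full_on_clopen[OF assms(3)] act_cont] by blast
  have "clopen_pred X (\<lambda>x. \<exists>\<alpha>\<in>N. \<exists>\<beta>\<in>N'. g x = act \<alpha> x \<and> (h (act \<gamma> x) = act \<beta> (act \<gamma> x) \<and>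
      P (act \<alpha> x) (act (\<beta> + \<gamma> - \<alpha>) (act \<alpha> x))))"
    by (intro clopen_pred_bex clopen_pred_conj N(1) N'(1) full_on_clopen[OF assms(2)] * **)
  then show "clopen_pred X (\<lambda>x. P (g x) (h (act \<gamma> x)))"
  proof (rule clopen_pred_cong)
    fix x assume x: "x \<in> topspace X"
    have "act (\<beta> + \<gamma> - \<alpha>) (act \<alpha> x) = act \<beta> (act \<gamma> x)" for \<alpha> \<beta>
      using act_add[OF x, of "\<beta> + \<gamma> - \<alpha>" \<alpha>] act_add[OF x] by simp
    then show "(\<exists>\<alpha>\<in>N. \<exists>\<beta>\<in>N'. g x = act \<alpha> x \<and> (h (act \<gamma> x) = act \<beta> (act \<gamma> x) \<and>
      P (act \<alpha> x) (act (\<beta> + \<gamma> - \<alpha>) (act \<alpha> x)))) \<longleftrightarrow> P (g x) (h (act \<gamma> x))"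
      using N(2)[OF x] N'(2)[OF act_in[OF x], of \<gamma>] by (simp, metis)
  qed
qed

lemma kernel_eq: "kernel (\<lambda>x y. x = y)"
  unfolding kernel_def
proof
  fix \<gamma>
  show "clopen_pred X (\<lambda>x. x = act \<gamma> x)"
    by (rule clopen_pred_cong[OF full_on_clopen[OF full_id]]) simp
qed

lemma clopen_pred_kernel:
  assumes "kernel P" "full g" shows "clopen_pred X (\<lambda>x. P x (g x))"
  using kernel_subst[OF assms(1) full_id assms(2)] unfolding kernel_def
  by (rule_tac clopen_pred_cong[of X "\<lambda>x. P x (g (act 0 x))"]) (simp_all add: act_zero)

lemma full_on_compose:
  assumes "full_on C g" "full_on C h" "\<And>\<alpha> \<beta>. \<alpha> \<in> C \<Longrightarrow> \<beta> \<in> C \<Longrightarrow> \<alpha> + \<beta> \<in> C"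
  shows "full_on C (\<lambda>x. g (h x))"
  unfolding full_on_def
proof (intro conjI allI)
  show "bij_betw (\<lambda>x. g (h x)) (topspace X) (topspace X)"
    using bij_betw_trans[OF full_on_bij[OF assms(2)] full_on_bij[OF assms(1)]] by (simp add: comp_def)
  obtain N where N: "N \<subseteq> C" "finite N" "\<And>x. x \<in> topspace X \<Longrightarrow> \<exists>\<gamma>\<in>N. g x = act \<gamma> x"
    by (rule full_on_obtain[OF assms(1)]) (rule that)
  obtain N' where N': "N' \<subseteq> C" "finite N'" "\<And>x. x \<in> topspace X \<Longrightarrow> \<exists>\<gamma>\<in>N'. h x = act \<gamma> x"
    by (rule full_on_obtain[OF assms(2)]) (rule that)
  show "\<exists>N\<subseteq>C. finite N \<and> (\<forall>x\<in>topspace X. \<exists>\<gamma>\<in>N. g (h x) = act \<gamma> x)"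
  proof (intro exI conjI ballI)
    let ?M = "(\<lambda>(\<alpha>, \<beta>). \<alpha> + \<beta>) ` (N \<times> N')"
    show "?M \<subseteq> C" using N(1) N'(1) assms(3) by auto
    show "finite ?M" using N N' by simp
    fix x assume x: "x \<in> topspace X"
    obtain \<beta> where "\<beta> \<in> N'" "h x = act \<beta> x" using N'(3) x by blast
    moreover obtain \<alpha> where "\<alpha> \<in> N" "g (h x) = act \<alpha> (h x)"
      using N(3) full_on_in[OF assms(2) x] by blast
    ultimately show "\<exists>\<gamma>\<in>?M. g (h x) = act \<gamma> x"
      using act_add[OF x] by (intro bexI[of _ "\<alpha> + \<beta>"]) auto
  qed
  show "clopen_pred X (\<lambda>x. g (h x) = act \<gamma> x)" for \<gamma>
  proof -
    \<comment> \<open>Substituting \<open>g\<close> and then \<open>h\<close> into the equality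
      relation gives a kernel whose condition at \<gamma> is the goal.\<close>
    have k: "kernel (\<lambda>x y. g x = y)"
      using kernel_subst[OF kernel_eq full_on_mono[OF assms(1)] full_id] .
    have "kernel (\<lambda>x y. g (h x) = y)"
      using kernel_subst[OF k full_on_mono[OF assms(2)] full_id] .
    then show ?thesis unfolding kernel_def by blast
  qed
qed

lemma full_on_inv:
  assumes "full_on C g" "\<And>\<alpha>. \<alpha> \<in> C \<Longrightarrow> - \<alpha> \<in> C"
  shows "full_on C (inv_into (topspace X) g)"
  unfolding full_on_def
proof (intro conjI allI)
  let ?g = "inv_into (topspace X) g"
  show bij: "bij_betw ?g (topspace X) (topspace X)"
    using full_on_bij[OF assms(1)] by (rule bij_betw_inv_into)
  have in': "?g x \<in> topspace X" if "x \<in> topspace X" for x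
    using bij that by (auto simp: bij_betw_def)
  have gg: "g (?g x) = x" if "x \<in> topspace X" for x
    using full_on_bij[OF assms(1)] that by (rule bij_betw_inv_into_right)
  obtain N where N: "N \<subseteq> C" "finite N" "\<And>x. x \<in> topspace X \<Longrightarrow> \<exists>\<gamma>\<in>N. g x = act \<gamma> x"
    by (rule full_on_obtain[OF assms(1)]) (rule that)
  show "\<exists>N\<subseteq>C. finite N \<and> (\<forall>x\<in>topspace X. \<exists>\<gamma>\<in>N. ?g x = act \<gamma> x)"
  proof (intro exI conjI ballI)
    show "uminus ` N \<subseteq> C" "finite (uminus ` N)" using N assms(2) by auto
    fix x assume x: "x \<in> topspace X"
    obtain \<gamma> where "\<gamma> \<in> N" "x = act \<gamma> (?g x)" using N(3)[OF in'[OF x]] gg[OF x] by auto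
    then show "\<exists>\<gamma>\<in>uminus ` N. ?g x = act \<gamma> x" using act_minus_act in'[OF x] by (metis imageI)
  qed
  show "clopen_pred X (\<lambda>x. ?g x = act \<gamma> x)" for \<gamma>
  proof -
    have k: "kernel (\<lambda>x y. x = g y)"
      using kernel_subst[OF kernel_eq full_id full_on_mono[OF assms(1)]] .
    then have "clopen_pred X (\<lambda>x. x = g (act \<gamma> x))" unfolding kernel_def by blast
    then show ?thesis
    proof (rule clopen_pred_cong)
      fix x assume "x \<in> topspace X"
      then show "(x = g (act \<gamma> x)) = (?g x = act \<gamma> x)"
        by (metis act_in full_on_inj[OF assms(1)] gg in')
    qed
  qed
qed

end

text \<open>
  \<open>Null\<close> plays the role of the coboundaries, or of the coboundaries plus twice all functions.
\<close>

locale free_action_null = free_action X act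
  for X :: "'x topology" and act :: "'i::group_add \<Rightarrow> 'x \<Rightarrow> 'x" +
  fixes Null :: "('x \<Rightarrow> int) set"
  assumes null_cong: "f \<in> Null \<Longrightarrow> (\<And>x. x \<in> topspace X \<Longrightarrow> f x = f' x) \<Longrightarrow> f' \<in> Null"
    and null_zero: "(\<lambda>x. 0) \<in> Null"
    and null_diff: "f \<in> Null \<Longrightarrow> f' \<in> Null \<Longrightarrow> (\<lambda>x. f x - f' x) \<in> Null"
    and null_shift: "locally_constant X f \<Longrightarrow> (\<lambda>x. f (act \<gamma> x) - f x) \<in> Null"
begin

lemma null_minus: "f \<in> Null \<Longrightarrow> (\<lambda>x. - f x) \<in> Null"
  using null_diff[OF null_zero] by fastforce

lemma null_add: "f \<in> Null \<Longrightarrow> f' \<in> Null \<Longrightarrow> (\<lambda>x. f x + f' x) \<in> Null"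
  using null_diff[OF _ null_minus, of f f'] by simp

lemma null_sum:
  assumes "finite N" "\<And>i. i \<in> N \<Longrightarrow> F i \<in> Null"
  shows "(\<lambda>x. \<Sum>i\<in>N. F i x) \<in> Null"
  using assms by (induction N) (simp_all add: null_zero null_add)

text \<open>Sort the pairs by displacement. Those leaving \<open>x\<close> by \<gamma> are counted
  by \<open>f \<gamma> x\<close>, those arriving at \<open>x\<close> by \<gamma> by its translate
  \<open>f \<gamma> (act (- \<gamma>) x)\<close>; each difference is null, and finitely many
  \<gamma> occur.\<close>

lemma mass_transport:
  assumes "finite_kernel P"
  shows "(\<lambda>x. cnt P x - cnt (\<lambda>x y. P y x) x) \<in> Null"
proof -
  obtain N where N: "supported N P" using assms by (auto simp: finite_kernel_def)
  have N': "supported (uminus ` N) (\<lambda>x y. P y x)" using supported_swap[OF N] .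
  define f :: "'i \<Rightarrow> 'x \<Rightarrow> int" where "f = (\<lambda>\<gamma> x. of_bool (P x (act \<gamma> x)))"
  have "(\<lambda>x. \<Sum>\<gamma>\<in>N. - (f \<gamma> (act (- \<gamma>) x) - f \<gamma> x)) \<in> Null"
    using N assms unfolding f_def supported_def finite_kernel_def kernel_def
    by (intro null_sum null_minus null_shift locally_constant_of_bool) auto
  then show ?thesis
  proof (rule null_cong)
    fix x assume x: "x \<in> topspace X"
    have "cnt (\<lambda>x y. P y x) x = (\<Sum>\<gamma>\<in>uminus ` N. of_bool (P (act \<gamma> x) x))"
      by (rule cnt_eq_sum[OF N' x])
    also have "\<dots> = (\<Sum>\<gamma>\<in>N. of_bool (P (act (- \<gamma>) x) x))"
      by (subst sum.reindex) (auto simp: inj_on_def)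
    also have "\<dots> = (\<Sum>\<gamma>\<in>N. f \<gamma> (act (- \<gamma>) x))"
      by (simp add: f_def act_act_minus x)
    finally show "(\<Sum>\<gamma>\<in>N. - (f \<gamma> (act (- \<gamma>) x) - f \<gamma> x)) = cnt P x - cnt (\<lambda>x y. P y x) x"
      using cnt_eq_sum[OF N x] by (simp add: f_def sum_subtractf)
  qed
qed

text \<open>Cut \<open>g\<close> into the pieces on which it is a single translation, cut
  \<open>f\<close> along the images of these pieces, and translate each part of \<open>f\<close> by
  its own \<gamma>.\<close>

lemma null_full_shift:
  assumes "full g" "locally_constant X f"
  shows "(\<lambda>x. f (g x) - f x) \<in> Null"
proof -
  obtain N where N: "finite N" "\<And>x. x \<in> topspace X \<Longrightarrow> \<exists>\<gamma>\<in>N. g x = act \<gamma> x"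
    by (rule full_on_obtain[OF assms(1)]) (rule that)
  \<comment> \<open>The first factor tests whether \<open>z\<close> lies in the image of the piece
    on which \<open>g\<close> is the translation by \<gamma>.\<close>
  define k :: "'i \<Rightarrow> 'x \<Rightarrow> int" where
    "k = (\<lambda>\<gamma> z. of_bool (z = g (act (- \<gamma>) z)) * f z)"
  have "clopen_pred X (\<lambda>z. z = g (act (- \<gamma>) z))" for \<gamma>
    using kernel_subst[OF kernel_eq full_id assms(1)] unfolding kernel_def by blast
  then have k: "locally_constant X (k \<gamma>)" for \<gamma>
    unfolding k_def
    by (rule locally_constant_combine[where F = "(*)", OF locally_constant_of_bool assms(2)])
  have "(\<lambda>x. \<Sum>\<gamma>\<in>N. k \<gamma> (act \<gamma> x) - k \<gamma> x) \<in> Null"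
    by (intro null_sum null_shift k N)
  then show ?thesis
  proof (rule null_cong)
    fix x assume x: "x \<in> topspace X"
    obtain \<gamma> where \<gamma>: "\<gamma> \<in> N" "g x = act \<gamma> x" using N(2) x by blast
    have "k \<delta> (act \<delta> x) = (if \<delta> = \<gamma> then f (g x) else 0)" for \<delta>
      using \<gamma>(2) x act_eq_iff[OF x, of \<delta> \<gamma>] by (auto simp: k_def act_minus_act)
    then have 1: "(\<Sum>\<delta>\<in>N. k \<delta> (act \<delta> x)) = f (g x)" using \<gamma>(1) N(1) by simp
    \<comment> \<open>The images of the pieces partition \<open>X\<close>: only the piece containing
      the preimage \<open>w\<close> has \<open>x\<close> in its image, so the sum collapses to
      \<open>f x\<close>.\<close>
    obtain w where w: "w \<in> topspace X" "g w = x"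
      using full_on_bij[OF assms(1)] x unfolding bij_betw_def by (metis imageE)
    obtain \<epsilon> where \<epsilon>: "\<epsilon> \<in> N" "x = act \<epsilon> w" using N(2) w by blast
    have eq: "x = g (act (- \<delta>) x) \<longleftrightarrow> \<delta> = \<epsilon>" for \<delta>
    proof -
      have "x = g (act (- \<delta>) x) \<longleftrightarrow> w = act (- \<delta>) x"
        using full_on_inj[OF assms(1) w(1) act_in[OF x]] w(2) by auto
      also have "\<dots> \<longleftrightarrow> act (- \<epsilon>) x = act (- \<delta>) x" using \<epsilon>(2) act_minus_act w(1) by metis
      also have "\<dots> \<longleftrightarrow> \<delta> = \<epsilon>" using act_eq_iff[OF x] by auto
      finally show ?thesis .
    qed
    have 2: "(\<Sum>\<delta>\<in>N. k \<delta> x) = f x" using \<epsilon>(1) N(1) by (simp add: k_def eq)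
    show "(\<Sum>\<gamma>\<in>N. k \<gamma> (act \<gamma> x) - k \<gamma> x) = f (g x) - f x"
      by (simp add: sum_subtractf 1 2)
  qed
qed

end

section \<open>The sign modulo two\<close>

text \<open>
  \<open>prec\<close> orients every pair of distinct points of an orbit and need not be transitive.
  By almost invariance a full group element reverses only finitely many pairs at each point.
\<close>

locale oriented_action = free_action_null X act Null
  for X :: "'x topology" and act :: "'i::group_add \<Rightarrow> 'x \<Rightarrow> 'x" and Null :: "('x \<Rightarrow> int) set" +
  fixes prec :: "'x \<Rightarrow> 'x \<Rightarrow> bool"
  assumes null_double: "locally_constant X f \<Longrightarrow> (\<lambda>x. 2 * f x) \<in> Null"
    and prec_kernel: "kernel prec"
    and prec_orbit: "x \<in> topspace X \<Longrightarrow> y \<in> topspace X \<Longrightarrow> prec x y \<Longrightarrow> \<exists>\<gamma>. y = act \<gamma> x"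
    and prec_irrefl: "x \<in> topspace X \<Longrightarrow> \<not> prec x x"
    and prec_flip: "x \<in> topspace X \<Longrightarrow> \<gamma> \<noteq> 0 \<Longrightarrow> prec x (act \<gamma> x) \<longleftrightarrow> \<not> prec (act \<gamma> x) x"
    and prec_almost_invariant:
      "finite {\<gamma>. \<exists>x\<in>topspace X. prec x (act \<gamma> x) \<and> \<not> prec (act \<alpha> x) (act \<beta> (act \<gamma> x))}"
begin

text \<open>A local form of the inversion number of a permutation: each reversed pair is counted
  once, at its earlier point.\<close>

definition inversions :: "('x \<Rightarrow> 'x) \<Rightarrow> 'x \<Rightarrow> int" where
  "inversions g = cnt (\<lambda>x y. prec x y \<and> \<not> prec (g x) (g y))"

definition even_full :: "('x \<Rightarrow> 'x) \<Rightarrow> bool" where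
  "even_full g \<longleftrightarrow> full g \<and> inversions g \<in> Null"

text \<open>A reversed pair is moved at its two ends by some \<alpha> and \<beta> from a finite set,
  and \<open>prec_almost_invariant\<close> leaves finitely many displacements for each
  choice.\<close>

lemma finite_kernel_inversions:
  assumes "full g"
  shows "finite_kernel (\<lambda>x y. prec x y \<and> \<not> prec (g x) (g y))"
  unfolding finite_kernel_def
proof
  show "kernel (\<lambda>x y. prec x y \<and> \<not> prec (g x) (g y))"
    by (intro kernel_conj prec_kernel kernel_not kernel_subst assms)
  obtain N where N: "finite N" "\<And>x. x \<in> topspace X \<Longrightarrow> \<exists>\<gamma>\<in>N. g x = act \<gamma> x"
    by (rule full_on_obtain[OF assms]) (rule that)
  let ?M = "\<Union>\<alpha>\<in>N. \<Union>\<beta>\<in>N.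
    {\<gamma>. \<exists>x\<in>topspace X. prec x (act \<gamma> x) \<and> \<not> prec (act \<alpha> x) (act \<beta> (act \<gamma> x))}"
  have "supported ?M (\<lambda>x y. prec x y \<and> \<not> prec (g x) (g y))"
    unfolding supported_def
  proof (intro conjI ballI impI)
    show "finite ?M" using N(1) prec_almost_invariant by simp
    fix x y assume x: "x \<in> topspace X" and y: "y \<in> topspace X" and p: "prec x y \<and> \<not> prec (g x) (g y)"
    obtain \<gamma> where \<gamma>: "y = act \<gamma> x" using prec_orbit x y p by blast
    obtain \<alpha> \<beta> where "\<alpha> \<in> N" "g x = act \<alpha> x" "\<beta> \<in> N" "g y = act \<beta> y" using N(2) x y by meson
    then have "\<gamma> \<in> ?M" using x p \<gamma> by auto
    then show "\<exists>\<gamma>\<in>?M. y = act \<gamma> x" using \<gamma> by blast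
  qed
  then show "\<exists>N. supported N (\<lambda>x y. prec x y \<and> \<not> prec (g x) (g y))" by blast
qed

lemma prec_flip_full:
  assumes "full g" "x \<in> topspace X" "x \<noteq> act \<gamma> x"
  shows "prec (g x) (g (act \<gamma> x)) \<longleftrightarrow> \<not> prec (g (act \<gamma> x)) (g x)"
proof -
  obtain N where N: "\<And>x. x \<in> topspace X \<Longrightarrow> \<exists>\<gamma>\<in>N. g x = act \<gamma> x"
    by (rule full_on_obtain[OF assms(1)]) (rule that)
  obtain \<alpha> where \<alpha>: "g x = act \<alpha> x" using N assms(2) by blast
  obtain \<beta> where \<beta>: "g (act \<gamma> x) = act \<beta> (act \<gamma> x)" using N act_in assms(2) by blast
  have eq: "g (act \<gamma> x) = act (\<beta> + \<gamma> - \<alpha>) (g x)"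
    using act_add[OF assms(2), of "\<beta> + \<gamma> - \<alpha>" \<alpha>] act_add[OF assms(2)] \<alpha> \<beta> by simp
  moreover have "g x \<noteq> g (act \<gamma> x)" using full_on_inj[OF assms(1,2)] act_in assms(2,3) by blast
  moreover have gx: "g x \<in> topspace X" using full_on_in assms by blast
  ultimately have "\<beta> + \<gamma> - \<alpha> \<noteq> 0" using act_zero by metis
  then show ?thesis using prec_flip[OF gx] eq by simp
qed

lemma prec_full_orbit:
  assumes "full g" "x \<in> topspace X" "y \<in> topspace X" "prec (g x) (g y)"
  shows "\<exists>\<gamma>. y = act \<gamma> x"
proof -
  obtain N where N: "\<And>x. x \<in> topspace X \<Longrightarrow> \<exists>\<gamma>\<in>N. g x = act \<gamma> x"
    by (rule full_on_obtain[OF assms(1)]) (rule that)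
  obtain \<alpha> where \<alpha>: "g x = act \<alpha> x" using N assms(2) by blast
  obtain \<beta> where \<beta>: "g y = act \<beta> y" using N assms(3) by blast
  obtain \<delta> where "g y = act \<delta> (g x)"
    using prec_orbit[OF full_on_in full_on_in] assms by blast
  then have "y = act (- \<beta>) (act \<delta> (act \<alpha> x))"
    using act_minus_act[OF assms(3), of \<beta>] \<alpha> \<beta> by simp
  then show ?thesis using act_add assms(2) act_in by metis
qed

lemma inversions_locally_constant: "full g \<Longrightarrow> locally_constant X (inversions g)"
  unfolding inversions_def by (intro cnt_locally_constant finite_kernel_inversions)

lemma inversions_cong:
  assumes "\<And>x. x \<in> topspace X \<Longrightarrow> g x = h x" "x \<in> topspace X"
  shows "inversions g x = inversions h x"
  unfolding inversions_def using assms by (intro cnt_cong) simp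

lemma inversions_id: "inversions (\<lambda>x. x) x = 0"
  by (simp add: inversions_def cnt_def)

text \<open>
  A pair is reversed by \<open>g \<circ> h\<close> iff exactly one of \<open>h\<close> on it and \<open>g\<close> on its \<open>h\<close>-image reverses.
  The pairs reversed by both are counted once at each endpoint.
\<close>

lemma inversions_compose:
  assumes g: "full g" and h: "full h"
  shows "(\<lambda>x. inversions (\<lambda>x. g (h x)) x - inversions g x - inversions h x) \<in> Null"
proof -
  let ?S = "topspace X"
  let ?hi = "inv_into ?S h"
  have hi: "?hi (h x) = x" if "x \<in> ?S" for x
    using full_on_bij[OF h] that by (simp add: bij_betw_def)
  have gh: "full (\<lambda>x. g (h x))" using full_on_compose[OF g h] by simp
  \<comment> \<open>The pairs that \<open>h\<close> reverses and \<open>g\<close> restores; they are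
    what spoils additivity over the integers.\<close>
  define C where "C = (\<lambda>x y. prec x y \<and> \<not> prec (h x) (h y) \<and> prec (g (h x)) (g (h y)))"
  have C: "finite_kernel C"
    using finite_kernel_conj[OF finite_kernel_inversions[OF h] kernel_subst[OF prec_kernel gh gh]]
    unfolding C_def by (simp add: conj_assoc)
  define A where "A = cnt (\<lambda>x y. (prec x y \<and> \<not> prec (g (h x)) (g (h y))) \<and> prec (h x) (h y))"
  define B where "B = cnt (\<lambda>x y. (prec x y \<and> \<not> prec (g (h x)) (g (h y))) \<and> \<not> prec (h x) (h y))"
  \<comment> \<open>The three counts are A + B for the composite, C + B for \<open>h\<close> and,
    taken at \<open>h x\<close>, A plus the transpose of \<open>C\<close> for \<open>g\<close>.
    Evaluating the count of \<open>g\<close> at \<open>h x\<close> makes the identity exact.\<close>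
  have main: "inversions (\<lambda>x. g (h x)) x - inversions g (h x) - inversions h x =
      - cnt C x - cnt (\<lambda>x y. C y x) x" if x: "x \<in> ?S" for x
  proof -
    have 1: "inversions (\<lambda>x. g (h x)) x = A x + B x"
      unfolding inversions_def A_def B_def by (rule cnt_split[OF finite_kernel_inversions[OF gh] x])
    have "inversions h x = cnt (\<lambda>x y. (prec x y \<and> \<not> prec (h x) (h y)) \<and> prec (g (h x)) (g (h y))) x
      + cnt (\<lambda>x y. (prec x y \<and> \<not> prec (h x) (h y)) \<and> \<not> prec (g (h x)) (g (h y))) x"
      unfolding inversions_def by (rule cnt_split[OF finite_kernel_inversions[OF h] x])
    also have "\<dots> = cnt C x + B x"
      unfolding C_def B_def by (intro arg_cong2[where f = "(+)"] cnt_cong) auto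
    finally have 2: "inversions h x = cnt C x + B x" .
    have "inversions g (h x) =
        cnt (\<lambda>z w. (prec z w \<and> \<not> prec (g z) (g w)) \<and> prec (?hi z) (?hi w)) (h x)
      + cnt (\<lambda>z w. (prec z w \<and> \<not> prec (g z) (g w)) \<and> \<not> prec (?hi z) (?hi w)) (h x)"
      unfolding inversions_def
      by (rule cnt_split[OF finite_kernel_inversions[OF g] full_on_in[OF h x]])
    also have "cnt (\<lambda>z w. (prec z w \<and> \<not> prec (g z) (g w)) \<and> prec (?hi z) (?hi w)) (h x) = A x"
      unfolding A_def by (rule cnt_reindex[OF full_on_bij[OF h], symmetric]) (auto simp: hi x)
    \<comment> \<open>If \<open>(h x, h y)\<close> is in order but its preimage is not, then
      \<open>y\<close> precedes \<open>x\<close>: the pair belongs to \<open>C\<close> with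
      \<open>x\<close> as second point.\<close>
    also have "cnt (\<lambda>z w. (prec z w \<and> \<not> prec (g z) (g w)) \<and> \<not> prec (?hi z) (?hi w)) (h x) =
        cnt (\<lambda>x y. C y x) x"
    proof (rule cnt_reindex[OF full_on_bij[OF h], symmetric])
      fix y assume y: "y \<in> ?S"
      show "C y x \<longleftrightarrow> (prec (h x) (h y) \<and> \<not> prec (g (h x)) (g (h y))) \<and> \<not> prec (?hi (h x)) (?hi (h y))"
      proof (cases "x \<noteq> y \<and> (\<exists>\<gamma>. y = act \<gamma> x)")
        case True
        then obtain \<gamma> where "y = act \<gamma> x" "x \<noteq> act \<gamma> x" by blast
        then have "prec x y \<longleftrightarrow> \<not> prec y x" "prec (h x) (h y) \<longleftrightarrow> \<not> prec (h y) (h x)"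
          "prec (g (h x)) (g (h y)) \<longleftrightarrow> \<not> prec (g (h y)) (g (h x))"
          using prec_flip_full[OF full_id x] prec_flip_full[OF h x] prec_flip_full[OF gh x] by auto
        then show ?thesis by (auto simp: C_def hi x y)
      next
        case False
        then have "\<not> prec y x"
          using prec_irrefl[OF x] prec_orbit[OF y x] act_minus_act[OF y] by metis
        moreover have "\<not> prec (h x) (h y)"
          using False prec_irrefl[OF full_on_in[OF h x]] prec_full_orbit[OF h x y] by auto
        ultimately show ?thesis by (simp add: C_def)
      qed
    qed
    finally show ?thesis using 1 2 by simp
  qed
  \<comment> \<open>By mass transport \<open>C\<close> and its transpose have the same class, so
    their sum has the class of a double and is null; the last bracket moves the count of
    \<open>g\<close> from \<open>h x\<close> back to \<open>x\<close>.\<close>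
  have "(\<lambda>x. (cnt C x - cnt (\<lambda>x y. C y x) x) - 2 * cnt C x + (inversions g (h x) - inversions g x)) \<in> Null"
    by (intro null_add null_diff mass_transport C null_double cnt_locally_constant
        null_full_shift[OF h] inversions_locally_constant g)
  then show ?thesis
    by (rule null_cong) (use main in fastforce)
qed

lemma even_full_cong:
  assumes "even_full g" "\<And>x. x \<in> topspace X \<Longrightarrow> g x = h x"
  shows "even_full h"
  using assms full_on_cong[of UNIV g h] null_cong[of "inversions g" "inversions h"] inversions_cong[of g h]
  unfolding even_full_def by blast

lemma even_full_id: "even_full (\<lambda>x. x)"
  unfolding even_full_def using full_id null_cong[OF null_zero] inversions_id by simp

lemma even_full_compose:
  assumes "even_full g" "even_full h" shows "even_full (\<lambda>x. g (h x))"
proof -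
  have "(\<lambda>x. (inversions (\<lambda>x. g (h x)) x - inversions g x - inversions h x) + inversions g x
      + inversions h x) \<in> Null"
    using assms unfolding even_full_def by (intro null_add inversions_compose) auto
  then show ?thesis using assms full_on_compose[of UNIV g h] by (simp add: even_full_def)
qed

lemma inversions_inv:
  assumes "full g"
  shows "(\<lambda>x. inversions g x + inversions (inv_into (topspace X) g) x) \<in> Null"
proof -
  have 1: "(\<lambda>x. - (inversions (\<lambda>x. g (inv_into (topspace X) g x)) x - inversions g x
      - inversions (inv_into (topspace X) g) x)) \<in> Null"
    using assms full_on_inv[of UNIV g] by (intro null_minus inversions_compose) auto
  have 2: "inversions (\<lambda>x. g (inv_into (topspace X) g x)) x = 0" if "x \<in> topspace X" for x
    using inversions_cong[of "\<lambda>x. g (inv_into (topspace X) g x)" "\<lambda>x. x" x]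
      bij_betw_inv_into_right[OF full_on_bij[OF assms]] that inversions_id by simp
  show ?thesis by (rule null_cong[OF 1]) (simp add: 2)
qed

lemma even_full_inv:
  assumes "even_full g" shows "even_full (inv_into (topspace X) g)"
proof -
  have "(\<lambda>x. (inversions g x + inversions (inv_into (topspace X) g) x) - inversions g x) \<in> Null"
    using assms unfolding even_full_def by (intro null_diff inversions_inv) auto
  then show ?thesis using assms full_on_inv[of UNIV g] by (simp add: even_full_def)
qed

text \<open>The sign takes values in an abelian group, so it vanishes on commutators; written out,
  five null functions telescope to the count of the commutator.\<close>

lemma even_full_commutator:
  assumes "full g" "full h"
  shows "even_full (\<lambda>x. g (h (inv_into (topspace X) g (inv_into (topspace X) h x))))"
proof -
  let ?gi = "inv_into (topspace X) g" and ?hi = "inv_into (topspace X) h"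
  have f: "full ?gi" "full ?hi" using full_on_inv[of UNIV] assms by auto
  have f2: "full (\<lambda>x. ?gi (?hi x))" using full_on_compose[OF f] by simp
  have f3: "full (\<lambda>x. h (?gi (?hi x)))" using full_on_compose[OF assms(2) f2] by simp
  have f4: "full (\<lambda>x. g (h (?gi (?hi x))))" using full_on_compose[OF assms(1) f3] by simp
  have "(\<lambda>x. (inversions (\<lambda>x. g (h (?gi (?hi x)))) x - inversions g x - inversions (\<lambda>x. h (?gi (?hi x))) x)
     + (inversions (\<lambda>x. h (?gi (?hi x))) x - inversions h x - inversions (\<lambda>x. ?gi (?hi x)) x)
     + (inversions (\<lambda>x. ?gi (?hi x)) x - inversions ?gi x - inversions ?hi x)
     + (inversions g x + inversions ?gi x) + (inversions h x + inversions ?hi x)) \<in> Null"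
    by (rule null_add[OF null_add[OF null_add[OF null_add[OF
        inversions_compose[OF assms(1) f3] inversions_compose[OF assms(2) f2]]
        inversions_compose[OF f]] inversions_inv[OF assms(1)]] inversions_inv[OF assms(2)]])
  then show ?thesis using f4 by (simp add: even_full_def)
qed

text \<open>
  A reversed pair \<open>(x, y)\<close> with \<open>y \<noteq> \<tau> x\<close> is partnered with \<open>(\<tau> y, \<tau> x)\<close>, and exactly one of the
  two satisfies \<open>prec x (\<tau> y)\<close>; so only the pairs \<open>(x, \<tau> x)\<close> contribute modulo two.
\<close>

lemma even_involution:
  assumes ev: "even_full \<tau>"
    and inv: "\<And>x. x \<in> topspace X \<Longrightarrow> \<tau> (\<tau> x) = x"
    and free: "\<And>x. x \<in> topspace X \<Longrightarrow> \<tau> x \<noteq> x"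
  shows "(\<lambda>x. of_bool (prec x (\<tau> x))) \<in> Null"
proof -
  let ?S = "topspace X"
  have \<tau>: "full \<tau>" using ev by (simp add: even_full_def)
  have \<tau>in: "\<tau> x \<in> ?S" if "x \<in> ?S" for x using full_on_in[OF \<tau> that] .
  have orbit: "\<exists>\<gamma>. \<tau> x = act \<gamma> x" if "x \<in> ?S" for x
    by (rule full_on_obtain[OF \<tau>]) (use that in blast)
  have flip: "prec x y \<longleftrightarrow> \<not> prec y x" if "x \<in> ?S" "y = act \<gamma> x" "x \<noteq> y" for x y \<gamma>
    using prec_flip_full[OF full_id that(1)] that by blast
  define P where "P = (\<lambda>x y. prec x y \<and> \<not> prec (\<tau> x) (\<tau> y))"
  define Q where "Q = (\<lambda>x y. (P x y \<and> \<tau> x \<noteq> y) \<and> prec x (\<tau> y))"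
  have P: "finite_kernel P" unfolding P_def by (rule finite_kernel_inversions[OF \<tau>])
  have PQ: "finite_kernel (\<lambda>x y. P x y \<and> \<tau> x \<noteq> y)"
    by (intro finite_kernel_conj P kernel_not kernel_subst[OF kernel_eq \<tau> full_id])
  have Q: "finite_kernel Q"
    unfolding Q_def by (intro finite_kernel_conj[OF PQ] kernel_subst[OF prec_kernel full_id \<tau>])
  \<comment> \<open>The partner of a pair at \<open>x\<close> that is not in \<open>Q\<close> has
    \<open>\<tau> x\<close> as its later point, hence the transposed count of \<open>Q\<close> at
    \<open>\<tau> x\<close>.\<close>
  have main: "inversions \<tau> x = of_bool (prec x (\<tau> x)) + cnt Q x + cnt (\<lambda>x y. Q y x) (\<tau> x)"
    if x: "x \<in> ?S" for x
  proof -
    \<comment> \<open>\<tau> exchanges the two points of this pair, so the pair is reversed whenever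
      it is in order.\<close>
    have "{y \<in> ?S. P x y \<and> \<not> \<tau> x \<noteq> y} = (if prec x (\<tau> x) then {\<tau> x} else {})"
      using x \<tau>in[OF x] orbit[OF x] free[OF x] flip[of x "\<tau> x"] inv[OF x] by (auto simp: P_def)
    then have 1: "cnt (\<lambda>x y. P x y \<and> \<not> \<tau> x \<noteq> y) x = of_bool (prec x (\<tau> x))"
      by (simp add: cnt_def)
    have 2: "cnt (\<lambda>x y. (P x y \<and> \<tau> x \<noteq> y) \<and> \<not> prec x (\<tau> y)) x = cnt (\<lambda>x y. Q y x) (\<tau> x)"
    proof (rule cnt_reindex[OF full_on_bij[OF \<tau>]])
      fix y assume y: "y \<in> ?S"
      show "(P x y \<and> \<tau> x \<noteq> y) \<and> \<not> prec x (\<tau> y) \<longleftrightarrow> Q (\<tau> y) (\<tau> x)"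
      proof (cases "(\<exists>\<gamma>. y = act \<gamma> x) \<and> x \<noteq> y \<and> \<tau> x \<noteq> y")
        case True
        then obtain \<gamma> where \<gamma>: "y = act \<gamma> x" by blast
        obtain \<delta> where \<delta>: "\<tau> y = act \<delta> y" using orbit[OF y] by blast
        have ne: "x \<noteq> \<tau> y" using inv[OF y] True by auto
        have "prec x y \<longleftrightarrow> \<not> prec y x" "prec (\<tau> x) (\<tau> y) \<longleftrightarrow> \<not> prec (\<tau> y) (\<tau> x)"
          using prec_flip_full[OF full_id x] prec_flip_full[OF \<tau> x] True \<gamma> by blast+
        moreover have "prec x (\<tau> y) \<longleftrightarrow> \<not> prec (\<tau> y) x"
          using flip[OF x, of "\<tau> y" "\<delta> + \<gamma>"] ne \<gamma> \<delta> act_add[OF x] by simp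
        ultimately show ?thesis using True ne by (auto simp: P_def Q_def inv x y)
      next
        case False
        have "\<not> (P x y \<and> \<tau> x \<noteq> y)"
          using False prec_orbit[OF x y] prec_irrefl[OF x] by (auto simp: P_def)
        moreover have "\<not> Q (\<tau> y) (\<tau> x)"
        proof
          assume "Q (\<tau> y) (\<tau> x)"
          then have q: "prec (\<tau> y) (\<tau> x)" "y \<noteq> \<tau> x" using inv[OF y] by (auto simp: Q_def P_def)
          then obtain \<gamma> where "x = act \<gamma> y" using prec_full_orbit[OF \<tau> y x] by blast
          then have "y = act (- \<gamma>) x" using act_minus_act[OF y] by simp
          moreover have "x \<noteq> y" using q(1) prec_irrefl[OF \<tau>in[OF x]] by auto
          ultimately show False using False q(2) by metis
        qed
        ultimately show ?thesis by blast
      qed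
    qed
    have "inversions \<tau> x = cnt (\<lambda>x y. P x y \<and> \<tau> x \<noteq> y) x + cnt (\<lambda>x y. P x y \<and> \<not> \<tau> x \<noteq> y) x"
      using cnt_split[OF P x, of "\<lambda>x y. \<tau> x \<noteq> y"] by (simp add: inversions_def P_def)
    moreover have "cnt (\<lambda>x y. P x y \<and> \<tau> x \<noteq> y) x = cnt Q x +
        cnt (\<lambda>x y. (P x y \<and> \<tau> x \<noteq> y) \<and> \<not> prec x (\<tau> y)) x"
      using cnt_split[OF PQ x, of "\<lambda>x y. prec x (\<tau> y)"] by (simp add: Q_def)
    ultimately show ?thesis using 1 2 by simp
  qed
  let ?Q' = "cnt (\<lambda>x y. Q y x)"
  \<comment> \<open>The transposed count is moved from \<open>\<tau> x\<close> to \<open>x\<close>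
    and replaced by \<open>cnt Q x\<close> through mass transport; what results is twice
    \<open>cnt Q x\<close>, which is null.\<close>
  have "(\<lambda>x. inversions \<tau> x - ((?Q' (\<tau> x) - ?Q' x) + (2 * cnt Q x - (cnt Q x - ?Q' x)))) \<in> Null"
    using ev unfolding even_full_def
    by (intro null_diff null_add null_double null_full_shift[OF \<tau>] mass_transport[OF Q]
        cnt_locally_constant[OF Q] cnt_locally_constant[OF finite_kernel_swap[OF Q]]) auto
  then show ?thesis by (rule null_cong) (simp add: main)
qed

end

section \<open>Full groups inside the group of bijections\<close>

lemma BijGroup_mult_apply:
  "g \<in> carrier (BijGroup S) \<Longrightarrow> h \<in> carrier (BijGroup S) \<Longrightarrow> x \<in> S \<Longrightarrow>
    (g \<otimes>\<^bsub>BijGroup S\<^esub> h) x = g (h x)"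
  by (simp add: BijGroup_def compose_eq)

lemma BijGroup_one_apply: "x \<in> S \<Longrightarrow> \<one>\<^bsub>BijGroup S\<^esub> x = x"
  by (simp add: BijGroup_def)

lemma BijGroup_carrier_iff:
  "g \<in> carrier (BijGroup S) \<longleftrightarrow> g \<in> extensional S \<and> bij_betw g S S"
  by (simp add: BijGroup_def Bij_def)

lemma BijGroup_in: "g \<in> carrier (BijGroup S) \<Longrightarrow> x \<in> S \<Longrightarrow> g x \<in> S"
  by (auto simp: BijGroup_carrier_iff bij_betw_def)

lemma BijGroup_inv_apply:
  assumes g: "g \<in> carrier (BijGroup S)" and x: "x \<in> S"
  shows "(inv\<^bsub>BijGroup S\<^esub> g) x = inv_into S g x"
proof -
  interpret B: group "BijGroup S" by (rule group_BijGroup)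
  have "g ((inv\<^bsub>BijGroup S\<^esub> g) x) = (g \<otimes>\<^bsub>BijGroup S\<^esub> inv\<^bsub>BijGroup S\<^esub> g) x"
    using g x by (simp only: BijGroup_mult_apply B.inv_closed)
  then have "g ((inv\<^bsub>BijGroup S\<^esub> g) x) = x" using g x by (simp add: BijGroup_one_apply)
  moreover have "(inv\<^bsub>BijGroup S\<^esub> g) x \<in> S" using BijGroup_in[OF B.inv_closed[OF g] x] .
  ultimately show ?thesis
    using g inv_into_f_f[of g S] by (metis BijGroup_carrier_iff bij_betw_def)
qed

lemma BijGroup_eqI:
  "g \<in> carrier (BijGroup S) \<Longrightarrow> h \<in> carrier (BijGroup S) \<Longrightarrow> (\<And>x. x \<in> S \<Longrightarrow> g x = h x) \<Longrightarrow> g = h"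
  by (metis BijGroup_carrier_iff extensionalityI)

lemma subgroup_homeos: "subgroup (homeos X) (BijGroup (topspace X))"
proof -
  let ?B = "BijGroup (topspace X)"
  interpret B: group ?B by (rule group_BijGroup)
  show ?thesis
  proof (rule B.subgroupI)
    show "homeos X \<subseteq> carrier ?B" by (auto simp: homeos_def)
    have "homeomorphic_map X X \<one>\<^bsub>?B\<^esub>"
      by (rule homeomorphic_map_eq[OF homeomorphic_map_id[THEN iffD2]]) (auto simp: BijGroup_one_apply)
    then have "\<one>\<^bsub>?B\<^esub> \<in> homeos X" by (simp add: homeos_def)
    then show "homeos X \<noteq> {}" by blast
  next
    fix g assume g: "g \<in> homeos X"
    then have gc: "g \<in> carrier ?B" and gm: "homeomorphic_map X X g" by (auto simp: homeos_def)
    obtain h where h: "homeomorphic_maps X X g h" using gm homeomorphic_map_maps by blast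
    have eq: "h x = (inv\<^bsub>?B\<^esub> g) x" if x: "x \<in> topspace X" for x
    proof -
      have "g (h x) = x" "h x \<in> topspace X"
        using h x by (auto simp: homeomorphic_maps_def continuous_map_def)
      then show ?thesis using gc x inv_into_f_f[of g "topspace X" "h x"]
        by (simp add: BijGroup_inv_apply BijGroup_carrier_iff bij_betw_def)
    qed
    have "homeomorphic_map X X h" using h homeomorphic_maps_sym homeomorphic_map_maps by blast
    then have "homeomorphic_map X X (inv\<^bsub>?B\<^esub> g)" using eq by (rule homeomorphic_map_eq)
    then show "inv\<^bsub>?B\<^esub> g \<in> homeos X" using gc by (simp add: homeos_def)
  next
    fix g h assume "g \<in> homeos X" "h \<in> homeos X"
    then have g: "g \<in> carrier ?B" "homeomorphic_map X X g"
      and h: "h \<in> carrier ?B" "homeomorphic_map X X h" by (auto simp: homeos_def)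
    have "homeomorphic_map X X (g \<circ> h)" using homeomorphic_map_compose h(2) g(2) by blast
    then have "homeomorphic_map X X (g \<otimes>\<^bsub>?B\<^esub> h)"
      by (rule homeomorphic_map_eq) (simp add: BijGroup_mult_apply g h)
    then show "g \<otimes>\<^bsub>?B\<^esub> h \<in> homeos X" using g h by (simp add: homeos_def)
  qed
qed

context free_action
begin

lemma subgroup_full_on:
  assumes "0 \<in> C" "\<And>\<alpha> \<beta>. \<alpha> \<in> C \<Longrightarrow> \<beta> \<in> C \<Longrightarrow> \<alpha> + \<beta> \<in> C" "\<And>\<alpha>. \<alpha> \<in> C \<Longrightarrow> - \<alpha> \<in> C"
  shows "subgroup {g \<in> carrier (BijGroup (topspace X)). full_on C g} (BijGroup (topspace X))"
proof -
  let ?B = "BijGroup (topspace X)"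
  interpret B: group ?B by (rule group_BijGroup)
  show ?thesis
  proof (rule B.subgroupI)
    have "full_on C \<one>\<^bsub>?B\<^esub>"
      by (rule full_on_cong[OF full_on_act[OF assms(1)]]) (simp add: act_zero BijGroup_one_apply)
    then show "{g \<in> carrier ?B. full_on C g} \<noteq> {}" by blast
    show "inv\<^bsub>?B\<^esub> g \<in> {g \<in> carrier ?B. full_on C g}" if "g \<in> {g \<in> carrier ?B. full_on C g}" for g
      using that full_on_cong[OF full_on_inv[of C g], of "inv\<^bsub>?B\<^esub> g"] assms(3)
      by (simp add: BijGroup_inv_apply)
    show "g \<otimes>\<^bsub>?B\<^esub> h \<in> {g \<in> carrier ?B. full_on C g}"
      if "g \<in> {g \<in> carrier ?B. full_on C g}" "h \<in> {g \<in> carrier ?B. full_on C g}" for g h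
      using that full_on_cong[OF full_on_compose[of C g h], of "g \<otimes>\<^bsub>?B\<^esub> h"] assms(2)
      by (simp add: BijGroup_mult_apply)
  qed auto
qed

text \<open>
  \<open>c\<close> is the cocycle of a groupoid of germs of the action, and \<open>e \<gamma> x\<close> the arrow with
  source \<open>x\<close> and cocycle value \<open>\<gamma>\<close>.
\<close>

lemma full_on_bisection_homeo:
  fixes Gd :: "('g, 'x) top_groupoid"
  assumes units: "units Gd = X"
    and c: "locally_constant (arrows Gd) c"
    and arrow: "\<And>g. g \<in> topspace (arrows Gd) \<Longrightarrow> c g \<in> C \<and> source_map Gd g \<in> topspace X \<and>
      range_map Gd g = act (c g) (source_map Gd g) \<and> e (c g) (source_map Gd g) = g"
    and e: "\<And>\<gamma>. \<gamma> \<in> C \<Longrightarrow> continuous_map X (arrows Gd) (e \<gamma>)"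
    and ce: "\<And>\<gamma> x. \<gamma> \<in> C \<Longrightarrow> x \<in> topspace X \<Longrightarrow> source_map Gd (e \<gamma> x) = x \<and> c (e \<gamma> x) = \<gamma>"
    and U: "full_bisection Gd U"
  shows "bisection_homeo Gd U \<in> {g \<in> carrier (BijGroup (topspace X)). full_on C g}"
proof -
  let ?s = "source_map Gd" and ?r = "range_map Gd"
  let ?t = "inv_into U ?s"
  have bs: "bij_betw ?s U (topspace X)" and br: "bij_betw ?r U (topspace X)"
    and Uc: "compactin (arrows Gd) U" and Uo: "openin (arrows Gd) U"
    using U units by (auto simp: full_bisection_def bij_betw_def)
  have Us: "g \<in> topspace (arrows Gd)" if "g \<in> U" for g using openin_subset[OF Uo] that by blast
  have t: "?t x \<in> U" "?s (?t x) = x" if "x \<in> topspace X" for x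
    using bs that by (metis bij_betw_def inv_into_into, metis bij_betw_inv_into_right)
  have val: "bisection_homeo Gd U x = act (c (?t x)) x" if "x \<in> topspace X" for x
    using t[OF that] arrow[OF Us] units that by (simp add: bisection_homeo_def)
  have bij: "bij_betw (bisection_homeo Gd U) (topspace X) (topspace X)"
  proof -
    have "bij_betw (?r \<circ> ?t) (topspace X) (topspace X)"
      using bij_betw_trans[OF bij_betw_inv_into[OF bs] br] .
    then show ?thesis
      using bij_betw_cong[of "topspace X" "bisection_homeo Gd U" "?r \<circ> ?t"]
      by (simp add: bisection_homeo_def units)
  qed
  have "full_on C (bisection_homeo Gd U)"
    unfolding full_on_def
  proof (intro conjI allI bij)
    \<comment> \<open>Compactness of \<open>U\<close> bounds the displacements: its image under the
      locally constant \<open>c\<close> is compact in a discrete space.\<close>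
    have "compactin (discrete_topology UNIV) (c ` U)" using image_compactin[OF Uc c] .
    then have "finite (c ` U)" by (simp add: compactin_discrete_topology)
    moreover have "c ` U \<subseteq> C" using arrow Us by blast
    moreover have "\<forall>x\<in>topspace X. \<exists>\<gamma>\<in>c ` U. bisection_homeo Gd U x = act \<gamma> x"
      using val t by blast
    ultimately show "\<exists>N\<subseteq>C. finite N \<and> (\<forall>x\<in>topspace X. \<exists>\<gamma>\<in>N. bisection_homeo Gd U x = act \<gamma> x)"
      by blast
  next
    fix \<gamma>
    \<comment> \<open>For \<gamma> in \<open>C\<close> the set is the preimage of the open set
      \<open>U\<close> under the section \<open>e \<gamma>\<close>: by freeness the value of the
      homeomorphism at \<open>x\<close> determines the displacement, hence the arrow of
      \<open>U\<close> with source \<open>x\<close>.\<close>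
    have op: "openin X {x \<in> topspace X. bisection_homeo Gd U x = act \<gamma> x}" for \<gamma>
    proof (cases "\<gamma> \<in> C")
      case True
      have "bisection_homeo Gd U x = act \<gamma> x \<longleftrightarrow> e \<gamma> x \<in> U" if x: "x \<in> topspace X" for x
      proof
        assume "bisection_homeo Gd U x = act \<gamma> x"
        then have "c (?t x) = \<gamma>" using val[OF x] act_eq_iff[OF x] by simp
        then have "e \<gamma> x = ?t x" using arrow[OF Us[OF t(1)[OF x]]] t(2)[OF x] by metis
        then show "e \<gamma> x \<in> U" using t(1)[OF x] by simp
      next
        assume "e \<gamma> x \<in> U"
        then have "?t x = e \<gamma> x"
          using ce[OF True x] bs by (metis bij_betw_inv_into_left)
        then show "bisection_homeo Gd U x = act \<gamma> x" using val[OF x] ce[OF True x] by simp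
      qed
      then have "{x \<in> topspace X. bisection_homeo Gd U x = act \<gamma> x} = {x \<in> topspace X. e \<gamma> x \<in> U}"
        by blast
      then show ?thesis using openin_continuous_map_preimage[OF e[OF True] Uo] by simp
    next
      case False
      have "bisection_homeo Gd U x \<noteq> act \<gamma> x" if x: "x \<in> topspace X" for x
        using False val[OF x] act_eq_iff[OF x] arrow[OF Us[OF t(1)[OF x]]] by metis
      then have "{x \<in> topspace X. bisection_homeo Gd U x = act \<gamma> x} = {}" by blast
      then show ?thesis by (simp only: openin_empty)
    qed
    \<comment> \<open>Over all displacements these open sets partition \<open>X\<close>, so the
      complement of one is a union of open sets.\<close>
    have "{x \<in> topspace X. bisection_homeo Gd U x \<noteq> act \<gamma> x} =
        (\<Union>\<delta>\<in>- {\<gamma>}. {x \<in> topspace X. bisection_homeo Gd U x = act \<delta> x})"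
      using val act_eq_iff by fastforce
    also have "openin X \<dots>" using op by blast
    finally show "clopen_pred X (\<lambda>x. bisection_homeo Gd U x = act \<gamma> x)"
      using op by (simp add: clopen_pred_def)
  qed
  then show ?thesis using bij units by (simp add: BijGroup_carrier_iff bisection_homeo_def)
qed

end

context oriented_action
begin

lemma subgroup_even_full:
  "subgroup {g \<in> carrier (BijGroup (topspace X)). even_full g} (BijGroup (topspace X))"
proof -
  let ?B = "BijGroup (topspace X)"
  interpret B: group ?B by (rule group_BijGroup)
  show ?thesis
  proof (rule B.subgroupI)
    have "even_full \<one>\<^bsub>?B\<^esub>" by (rule even_full_cong[OF even_full_id]) (simp add: BijGroup_one_apply)
    then show "{g \<in> carrier ?B. even_full g} \<noteq> {}" by blast
    show "inv\<^bsub>?B\<^esub> g \<in> {g \<in> carrier ?B. even_full g}" if "g \<in> {g \<in> carrier ?B. even_full g}" for g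
      using that even_full_cong[OF even_full_inv[of g], of "inv\<^bsub>?B\<^esub> g"]
      by (simp add: BijGroup_inv_apply)
    show "g \<otimes>\<^bsub>?B\<^esub> h \<in> {g \<in> carrier ?B. even_full g}"
      if "g \<in> {g \<in> carrier ?B. even_full g}" "h \<in> {g \<in> carrier ?B. even_full g}" for g h
      using that even_full_cong[OF even_full_compose[of g h], of "g \<otimes>\<^bsub>?B\<^esub> h"]
      by (simp add: BijGroup_mult_apply)
  qed auto
qed

lemma derived_even_full:
  assumes "F \<subseteq> {g \<in> carrier (BijGroup (topspace X)). full g}"
  shows "derived (BijGroup (topspace X)) F \<subseteq> {g \<in> carrier (BijGroup (topspace X)). even_full g}"
proof -
  let ?B = "BijGroup (topspace X)"
  interpret B: group ?B by (rule group_BijGroup)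
  have "g \<otimes>\<^bsub>?B\<^esub> h \<otimes>\<^bsub>?B\<^esub> inv\<^bsub>?B\<^esub> g \<otimes>\<^bsub>?B\<^esub> inv\<^bsub>?B\<^esub> h \<in> {g \<in> carrier ?B. even_full g}"
    if "g \<in> F" "h \<in> F" for g h
  proof -
    have c: "g \<in> carrier ?B" "h \<in> carrier ?B" and f: "full g" "full h" using that assms by auto
    have "even_full (g \<otimes>\<^bsub>?B\<^esub> h \<otimes>\<^bsub>?B\<^esub> inv\<^bsub>?B\<^esub> g \<otimes>\<^bsub>?B\<^esub> inv\<^bsub>?B\<^esub> h)"
    proof (rule even_full_cong[OF even_full_commutator[OF f]])
      fix x assume x: "x \<in> topspace X"
      have "inv_into (topspace X) h x \<in> topspace X"
        using BijGroup_in[OF B.inv_closed[OF c(2)] x] BijGroup_inv_apply[OF c(2) x] by simp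
      then show "g (h (inv_into (topspace X) g (inv_into (topspace X) h x))) =
          (g \<otimes>\<^bsub>?B\<^esub> h \<otimes>\<^bsub>?B\<^esub> inv\<^bsub>?B\<^esub> g \<otimes>\<^bsub>?B\<^esub> inv\<^bsub>?B\<^esub> h) x"
        using x c BijGroup_in[OF B.inv_closed[OF c(1)]]
        by (simp add: BijGroup_mult_apply BijGroup_inv_apply)
    qed
    then show ?thesis using c by simp
  qed
  then show ?thesis
    unfolding derived_def by (intro B.generate_subgroup_incl subgroup_even_full) auto
qed

end

section \<open>Commuting homeomorphisms of a Cantor set\<close>

lemma cantor_space_infinite: assumes "cantor_space X" shows "infinite (topspace X)"
proof
  assume fin: "finite (topspace X)"
  obtain f where f: "homeomorphic_map X
      (product_topology (\<lambda>_::nat. discrete_topology (UNIV :: bool set)) UNIV) f"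
    using assms by (auto simp: cantor_space_def homeomorphic_space)
  have "f ` topspace X = UNIV" using homeomorphic_imp_surjective_map[OF f] by simp
  then have "finite (UNIV :: (nat \<Rightarrow> bool) set)" using fin by (metis finite_imageI)
  then show False using finite_fun_UNIVD1[where 'a = nat and 'b = bool] by simp
qed

lemma cantor_space_Hausdorff: assumes "cantor_space X" shows "Hausdorff_space X"
  using homeomorphic_Hausdorff_space[OF assms[unfolded cantor_space_def]]
  by (simp add: Hausdorff_space_product_topology)

text \<open>Compare \<open>x\<close> with \<open>T x\<close> in the lexicographic order of \<open>{0, 1}\<^sup>\<nat>\<close>.\<close>

lemma involution_fundamental_domain:
  assumes X: "cantor_space X" and T: "continuous_map X X T"
    and inv: "\<And>x. x \<in> topspace X \<Longrightarrow> T (T x) = x" and free: "\<And>x. x \<in> topspace X \<Longrightarrow> T x \<noteq> x"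
  obtains p where "clopen_pred X p" "\<And>x. x \<in> topspace X \<Longrightarrow> p (T x) \<longleftrightarrow> \<not> p x"
proof -
  obtain f where f: "homeomorphic_map X
      (product_topology (\<lambda>_::nat. discrete_topology (UNIV :: bool set)) UNIV) f"
    using X by (auto simp: cantor_space_def homeomorphic_space)
  have Tin: "T x \<in> topspace X" if "x \<in> topspace X" for x using T that by (auto simp: continuous_map_def)
  have "continuous_map X (discrete_topology UNIV) (\<lambda>x. f x n)" for n
    using continuous_map_compose[OF homeomorphic_imp_continuous_map[OF f]
        continuous_map_product_projection[of n UNIV]] by (simp add: comp_def)
  then have cl: "clopen_pred X (\<lambda>x. f x n)" for n
    using clopen_pred_locally_constant[of X "\<lambda>x. f x n" "\<lambda>b. b"] by simp
  \<comment> \<open>One coordinate of the comparison: it involves finitely many coordinates and is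
    clopen, while the full comparison \<open>p\<close>, an infinite union, is at first only
    open.\<close>
  define lt where "lt = (\<lambda>n x. (\<forall>m<n. f x m = f (T x) m) \<and> \<not> f x n \<and> f (T x) n)"
  have clT: "clopen_pred X (\<lambda>x. f (T x) n)" for n by (rule clopen_pred_compose[OF cl T])
  have eq: "clopen_pred X (\<lambda>x. f x m = f (T x) m)" for m
    by (rule clopen_pred_cong[OF clopen_pred_disj[OF clopen_pred_conj[OF cl[of m] clT[of m]]
          clopen_pred_conj[OF clopen_pred_not[OF cl[of m]] clopen_pred_not[OF clT[of m]]]]]) auto
  have "clopen_pred X (\<lambda>x. \<not> (\<exists>m\<in>{..<n}. \<not> (f x m = f (T x) m)) \<and> \<not> f x n \<and> f (T x) n)" for n
    by (intro clopen_pred_conj clopen_pred_not clopen_pred_bex eq cl clT) auto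
  then have lt: "clopen_pred X (lt n)" for n
    by (rule clopen_pred_cong) (auto simp: lt_def)
  define p where "p = (\<lambda>x. \<exists>n. lt n x)"
  have flip: "p (T x) \<longleftrightarrow> \<not> p x" if x: "x \<in> topspace X" for x
  proof -
    have "f x \<noteq> f (T x)"
      using homeomorphic_imp_injective_map[OF f] x Tin[OF x] free[OF x] by (metis inj_onD)
    then obtain k where "f x k \<noteq> f (T x) k" by blast
    then obtain n where n: "f x n \<noteq> f (T x) n" "\<And>m. m < n \<Longrightarrow> f x m = f (T x) m"
      using exists_least_iff[of "\<lambda>n. f x n \<noteq> f (T x) n"] by blast
    have u: "m = n" if "\<forall>l<m. f x l = f (T x) l" "f x m \<noteq> f (T x) m" for m
      using that n by (metis linorder_neqE_nat)
    have "p x \<longleftrightarrow> \<not> f x n" using n u unfolding p_def lt_def by metis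
    moreover have "p (T x) \<longleftrightarrow> f x n" using n u unfolding p_def lt_def inv[OF x] by metis
    ultimately show ?thesis by blast
  qed
  have op: "openin X {x \<in> topspace X. p x}"
  proof -
    have "{x \<in> topspace X. p x} = (\<Union>n. {x \<in> topspace X. lt n x})" by (auto simp: p_def)
    also have "openin X \<dots>" using lt by (auto simp: clopen_pred_def)
    finally show ?thesis .
  qed
  \<comment> \<open>The complement of the open set is its preimage under \<open>T\<close>, hence
    open too.\<close>
  have "{x \<in> topspace X. \<not> p x} = {x \<in> topspace X. T x \<in> {x \<in> topspace X. p x}}"
    using flip Tin by auto
  then have "openin X {x \<in> topspace X. \<not> p x}"
    using openin_continuous_map_preimage[OF T op] by simp
  then show thesis using that op flip by (simp add: clopen_pred_def)
qed

section \<open>The free action of Z x Z/2 generated by \<phi> and \<open>T\<close>\<close>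

locale minimal_with_involution =
  fixes X :: "'x topology" and \<phi> T :: "'x \<Rightarrow> 'x"
  assumes cantor: "cantor_space X"
    and \<phi>: "\<phi> \<in> homeos X" and minimal: "minimal_homeo X \<phi>"
    and T: "T \<in> homeos X" and T_neq: "T \<noteq> \<one>\<^bsub>BijGroup (topspace X)\<^esub>"
    and T_T: "T \<otimes>\<^bsub>BijGroup (topspace X)\<^esub> T = \<one>\<^bsub>BijGroup (topspace X)\<^esub>"
    and T_\<phi>: "T \<otimes>\<^bsub>BijGroup (topspace X)\<^esub> \<phi> = \<phi> \<otimes>\<^bsub>BijGroup (topspace X)\<^esub> T"
begin

abbreviation B where "B \<equiv> BijGroup (topspace X)"

sublocale B: group B by (rule group_BijGroup)

text \<open>\<open>free_action\<close> takes the acting group as a type of class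
  \<open>group_add\<close>; \<open>bit\<close>, the field with two elements, supplies Z/2. The
  second component records whether \<open>T\<close> occurs, which later tells \<G> apart from the
  rest of \<H>.\<close>

definition shift :: "int \<times> bit \<Rightarrow> 'x \<Rightarrow> 'x" where
  "shift \<gamma> = \<phi> [^]\<^bsub>B\<^esub> fst \<gamma> \<otimes>\<^bsub>B\<^esub> (if snd \<gamma> = 1 then T else \<one>\<^bsub>B\<^esub>)"

lemma carriers: "\<phi> \<in> carrier B" "T \<in> carrier B"
  using \<phi> T by (auto simp: homeos_def)

lemma \<phi>_funcset: "\<phi> \<in> topspace X \<rightarrow> topspace X"
  by (rule funcsetI) (rule BijGroup_in[OF carriers(1)])

lemma shift_homeo: "shift \<gamma> \<in> homeos X"
  unfolding shift_def
  by (rule subgroup.m_closed[OF subgroup_homeos B.subgroup_int_pow_closed[OF subgroup_homeos \<phi>]])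
     (simp add: T subgroup.one_closed[OF subgroup_homeos])

lemma shift_carrier: "shift \<gamma> \<in> carrier B"
  using shift_homeo by (auto simp: homeos_def)

lemma shift_continuous: "continuous_map X X (shift \<gamma>)"
  using shift_homeo[of \<gamma>] by (simp add: homeos_def homeomorphic_imp_continuous_map)

lemma T_pow: "T \<otimes>\<^bsub>B\<^esub> \<phi> [^]\<^bsub>B\<^esub> (k::int) = \<phi> [^]\<^bsub>B\<^esub> k \<otimes>\<^bsub>B\<^esub> T"
proof -
  have n: "T \<otimes>\<^bsub>B\<^esub> \<phi> [^]\<^bsub>B\<^esub> (n::nat) = \<phi> [^]\<^bsub>B\<^esub> n \<otimes>\<^bsub>B\<^esub> T" for n
    using B.group_commutes_pow[of \<phi> T n] T_\<phi> carriers by simp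
  show ?thesis
  proof (cases "k \<ge> 0")
    case True
    then obtain m where "k = int m" using nonneg_int_cases by blast
    then show ?thesis by (simp only: int_pow_int n)
  next
    case False
    then obtain m where m: "k = - int m" by (metis int_cases2 nonneg_int_cases nle_le of_nat_0_le_iff)
    let ?p = "\<phi> [^]\<^bsub>B\<^esub> m"
    have p: "?p \<in> carrier B" using carriers by simp
    have "?p \<otimes>\<^bsub>B\<^esub> (T \<otimes>\<^bsub>B\<^esub> inv\<^bsub>B\<^esub> ?p) = T \<otimes>\<^bsub>B\<^esub> ?p \<otimes>\<^bsub>B\<^esub> inv\<^bsub>B\<^esub> ?p"
      unfolding n using p carriers B.m_assoc B.inv_closed by metis
    also have "\<dots> = T" using p carriers by (simp add: B.m_assoc)
    finally have "T \<otimes>\<^bsub>B\<^esub> inv\<^bsub>B\<^esub> ?p = inv\<^bsub>B\<^esub> ?p \<otimes>\<^bsub>B\<^esub> T"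
      using p carriers by (subst B.inv_solve_left) simp_all
    then show ?thesis by (simp only: m B.int_pow_neg_int[OF carriers(1)])
  qed
qed

lemma shift_add: "shift (\<gamma> + \<delta>) = shift \<gamma> \<otimes>\<^bsub>B\<^esub> shift \<delta>"
proof -
  define t where "t = (\<lambda>b::bit. if b = 1 then T else \<one>\<^bsub>B\<^esub>)"
  have tc: "t b \<in> carrier B" for b using carriers by (simp add: t_def)
  have tadd: "t (b + c) = t b \<otimes>\<^bsub>B\<^esub> t c" for b c
    using T_T carriers by (cases b; cases c) (simp_all add: t_def)
  have tcomm: "t b \<otimes>\<^bsub>B\<^esub> \<phi> [^]\<^bsub>B\<^esub> (k::int) = \<phi> [^]\<^bsub>B\<^esub> k \<otimes>\<^bsub>B\<^esub> t b" for b k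
    using T_pow carriers by (simp add: t_def)
  have sh: "shift (k, b) = \<phi> [^]\<^bsub>B\<^esub> k \<otimes>\<^bsub>B\<^esub> t b" for k b
    by (simp add: shift_def t_def)
  let ?p = "\<lambda>k::int. \<phi> [^]\<^bsub>B\<^esub> k"
  obtain k b l c where \<gamma>: "\<gamma> = (k, b)" and \<delta>: "\<delta> = (l, c)" by fastforce
  have "shift \<gamma> \<otimes>\<^bsub>B\<^esub> shift \<delta> = ?p k \<otimes>\<^bsub>B\<^esub> (t b \<otimes>\<^bsub>B\<^esub> ?p l) \<otimes>\<^bsub>B\<^esub> t c"
    using carriers tc by (simp add: sh \<gamma> \<delta> B.m_assoc)
  also have "\<dots> = (?p k \<otimes>\<^bsub>B\<^esub> ?p l) \<otimes>\<^bsub>B\<^esub> (t b \<otimes>\<^bsub>B\<^esub> t c)"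
    unfolding tcomm using carriers tc by (simp add: B.m_assoc)
  also have "\<dots> = shift (\<gamma> + \<delta>)"
    using carriers by (simp add: sh \<gamma> \<delta> B.int_pow_mult tadd del: add_bit_eq_xor)
  finally show ?thesis by simp
qed

lemma shift_zero: "shift 0 = \<one>\<^bsub>B\<^esub>"
  using carriers by (simp add: shift_def)

lemma shift_one: "shift (1, 0) = \<phi>" "shift (0, 1) = T"
  using carriers by (simp_all add: shift_def)

lemma shift_int: "shift (k, 0) = \<phi> [^]\<^bsub>B\<^esub> k"
  using carriers by (simp add: shift_def)

lemma shift_add_apply: "x \<in> topspace X \<Longrightarrow> shift (\<gamma> + \<delta>) x = shift \<gamma> (shift \<delta> x)"
  by (simp add: shift_add BijGroup_mult_apply shift_carrier)

lemma shift_zero_apply: "x \<in> topspace X \<Longrightarrow> shift 0 x = x"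
  by (simp add: shift_zero BijGroup_one_apply)

lemma shift_in: "x \<in> topspace X \<Longrightarrow> shift \<gamma> x \<in> topspace X"
  by (rule BijGroup_in[OF shift_carrier])

lemma orbit_dense: "x \<in> topspace X \<Longrightarrow> X closure_of range (\<lambda>n. shift (n, 0) x) = topspace X"
proof -
  have "{(\<phi> [^]\<^bsub>B\<^esub> n) x | n::int. True} = range (\<lambda>n. shift (n, 0) x)"
    by (auto simp: shift_int)
  then show "x \<in> topspace X \<Longrightarrow> X closure_of range (\<lambda>n. shift (n, 0) x) = topspace X"
    using minimal unfolding minimal_homeo_def by metis
qed

text \<open>A point fixed by a nonzero power of \<phi> has a finite orbit, which is closed in a
  Hausdorff space; being dense, it would be all of the infinite space \<open>X\<close>.\<close>

lemma aperiodic: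
  assumes x: "x \<in> topspace X" and k: "shift (k, 0) x = x"
  shows "k = 0"
proof (rule ccontr)
  assume k0: "k \<noteq> 0"
  have mult: "shift (k * q, 0) x = x" for q
  proof (induction q rule: int_induct[where k = 0])
    case base
    then show ?case using shift_zero_apply[OF x] by (simp add: zero_prod_def)
  next
    case (step1 i)
    have "shift (k * (i + 1), 0) x = shift ((k, 0) + (k * i, 0)) x" by (simp add: algebra_simps)
    then show ?case using step1(2) k by (simp only: shift_add_apply[OF x])
  next
    case (step2 i)
    have "shift (k * i, 0) x = shift ((k, 0) + (k * (i - 1), 0)) x" by (simp add: algebra_simps)
    then have "shift (k, 0) (shift (k * (i - 1), 0) x) = shift (k, 0) x"
      using step2(2) k by (simp only: shift_add_apply[OF x])
    then show ?case
      using shift_carrier[of "(k, 0)"] x shift_in[OF x]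
      unfolding BijGroup_carrier_iff bij_betw_def by (metis inj_onD)
  qed
  have "range (\<lambda>n. shift (n, 0) x) \<subseteq> (\<lambda>n. shift (n, 0) x) ` {- \<bar>k\<bar>..\<bar>k\<bar>}"
  proof clarify
    fix n
    have "shift (n, 0) x = shift ((n mod k, 0) + (k * (n div k), 0)) x" by simp
    then have "shift (n, 0) x = shift (n mod k, 0) x" using mult by (simp only: shift_add_apply[OF x])
    moreover have "n mod k \<in> {- \<bar>k\<bar>..\<bar>k\<bar>}" using abs_mod_less[OF k0, of n] by auto
    ultimately show "shift (n, 0) x \<in> (\<lambda>n. shift (n, 0) x) ` {- \<bar>k\<bar>..\<bar>k\<bar>}" by blast
  qed
  then have "finite (range (\<lambda>n. shift (n, 0) x))" using finite_subset by blast
  moreover from this have "closedin X (range (\<lambda>n. shift (n, 0) x))"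
    by (intro closedin_Hausdorff_finite[OF cantor_space_Hausdorff[OF cantor]])
       (use shift_in[OF x] in auto)
  then have "range (\<lambda>n. shift (n, 0) x) = topspace X"
    using orbit_dense[OF x] closure_of_closedin by metis
  ultimately show False using cantor_space_infinite[OF cantor] by simp
qed

text \<open>The fixed points of \<open>T\<close> form a closed set, invariant under \<phi> because
  \<open>T\<close> commutes with it. If nonempty, it contains a dense orbit, and \<open>T\<close> is
  the identity.\<close>

lemma T_free:
  assumes x: "x \<in> topspace X" shows "T x \<noteq> x"
proof
  assume fx: "T x = x"
  let ?F = "{y \<in> topspace X. T y = y}"
  have Tc: "continuous_map X X T" using shift_continuous[of "(0, 1)"] by (simp add: shift_one)
  have cl: "closedin X ?F"
    using closedin_continuous_maps_eq[OF cantor_space_Hausdorff[OF cantor] Tc, of id] by simp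
  have "T (shift (n, 0) x) = shift (n, 0) x" for n
  proof -
    have "T (shift (n, 0) x) = shift ((0, 1) + (n, 0)) x"
      by (simp only: shift_add_apply[OF x] shift_one)
    also have "\<dots> = shift ((n, 0) + (0, 1)) x" by simp
    also have "\<dots> = shift (n, 0) x" by (simp only: shift_add_apply[OF x] shift_one fx)
    finally show ?thesis .
  qed
  then have "range (\<lambda>n. shift (n, 0) x) \<subseteq> ?F" using shift_in[OF x] by auto
  then have "topspace X \<subseteq> ?F" using closure_of_minimal[OF _ cl] unfolding orbit_dense[OF x, symmetric] by blast
  then have "T = \<one>\<^bsub>B\<^esub>"
    using carriers by (intro BijGroup_eqI) (auto simp: BijGroup_one_apply)
  then show False using T_neq by simp
qed

sublocale free_action X shift
proof
  fix x \<gamma> assume x: "x \<in> topspace X" and fx: "shift \<gamma> x = x"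
  obtain k b where \<gamma>: "\<gamma> = (k, b)" by fastforce
  \<comment> \<open>Doubling kills the Z/2 component and reduces to \<open>aperiodic\<close>; what
    is left is \<open>T\<close> itself.\<close>
  have "shift (\<gamma> + \<gamma>) x = x" using fx by (simp add: shift_add_apply x)
  moreover have "\<gamma> + \<gamma> = (k + k, 0)" using \<gamma> by simp
  ultimately have "k = 0" using aperiodic[OF x, of "k + k"] by simp
  moreover have "b = 0"
    using T_free[OF x] fx \<gamma> \<open>k = 0\<close> shift_one by (cases b) auto
  ultimately show "\<gamma> = 0" using \<gamma> by (simp add: zero_prod_def)
qed (simp_all add: shift_continuous shift_add_apply shift_zero_apply)

lemma oriented_action_exists:
  assumes "free_action_null X shift Null"
    and double: "\<And>f. locally_constant X f \<Longrightarrow> (\<lambda>x. 2 * f x) \<in> Null"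
  obtains prec where "oriented_action X shift Null prec"
proof -
  have Tc: "continuous_map X X T" using shift_continuous[of "(0, 1)"] by (simp add: shift_one)
  have TT: "T (T x) = x" if "x \<in> topspace X" for x
    using shift_add_apply[OF that, of "(0, 1)" "(0, 1)"] shift_zero_apply[OF that]
    by (simp add: shift_one zero_prod_def)
  obtain p where p: "clopen_pred X p" "\<And>x. x \<in> topspace X \<Longrightarrow> p (T x) \<longleftrightarrow> \<not> p x"
    using involution_fundamental_domain[OF cantor Tc TT T_free] by blast
  \<comment> \<open>Positive powers of \<phi> point forward. The displacement \<open>(0, 1)\<close>
    is its own negative, so there the direction has to depend on the point: \<open>p\<close> selects
    one point of each pair.\<close>
  define prec where "prec = (\<lambda>x y. \<exists>\<gamma> :: int \<times> bit. y = shift \<gamma> x \<and> (fst \<gamma> > 0 \<or> \<gamma> = (0, 1) \<and> p x))"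
  have prec: "prec x (shift \<gamma> x) \<longleftrightarrow> fst \<gamma> > 0 \<or> \<gamma> = (0, 1) \<and> p x" if "x \<in> topspace X" for x \<gamma>
    using act_eq_iff[OF that] unfolding prec_def by auto
  interpret free_action_null X shift Null by (rule assms(1))
  have "oriented_action X shift Null prec"
  proof unfold_locales
    show "(\<lambda>x. 2 * f x) \<in> Null" if "locally_constant X f" for f using double that .
    show "kernel prec"
      unfolding kernel_def
    proof
      fix \<gamma> :: "int \<times> bit"
      have "clopen_pred X (\<lambda>x. fst \<gamma> > 0 \<or> \<gamma> = (0, 1) \<and> p x)"
        by (intro clopen_pred_disj clopen_pred_conj clopen_pred_const p)
      then show "clopen_pred X (\<lambda>x. prec x (shift \<gamma> x))"
        by (rule clopen_pred_cong) (simp add: prec)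
    qed
    show "\<exists>\<gamma>. y = shift \<gamma> x" if "prec x y" for x y using that unfolding prec_def by blast
    show "\<not> prec x x" if "x \<in> topspace X" for x
      using prec[OF that, of 0] shift_zero_apply[OF that] by (simp add: zero_prod_def)
    show "prec x (shift \<gamma> x) \<longleftrightarrow> \<not> prec (shift \<gamma> x) x" if x: "x \<in> topspace X" and "\<gamma> \<noteq> 0" for x \<gamma>
    proof -
      obtain k b where \<gamma>: "\<gamma> = (k, b)" by fastforce
      have "prec (shift \<gamma> x) x \<longleftrightarrow> prec (shift \<gamma> x) (shift (- \<gamma>) (shift \<gamma> x))"
        using act_minus_act[OF x] by simp
      also have "\<dots> \<longleftrightarrow> fst (- \<gamma>) > 0 \<or> - \<gamma> = (0, 1) \<and> p (shift \<gamma> x)" by (rule prec[OF act_in[OF x]])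
      finally have 1: "prec (shift \<gamma> x) x \<longleftrightarrow> fst (- \<gamma>) > 0 \<or> - \<gamma> = (0, 1) \<and> p (shift \<gamma> x)" .
      show ?thesis
      proof (cases "k = 0")
        case True
        then have "\<gamma> = (0, 1)" using \<gamma> \<open>\<gamma> \<noteq> 0\<close> by (cases b) (auto simp: zero_prod_def)
        then show ?thesis using 1 prec[OF x, of \<gamma>] p(2)[OF x] by (simp add: shift_one)
      qed (use 1 prec[OF x, of \<gamma>] \<gamma> in auto)
    qed
    fix \<alpha> \<beta>
    \<comment> \<open>Before the move the power \<open>k\<close> is at least 0, after it
      \<open>fst \<beta> + k - fst \<alpha>\<close> is at most 0. Both bounds include 0, which
      leaves room for the pairs whose order depends on \<open>p\<close>.\<close>
    have "{\<gamma>. \<exists>x\<in>topspace X. prec x (shift \<gamma> x) \<and> \<not> prec (shift \<alpha> x) (shift \<beta> (shift \<gamma> x))}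
      \<subseteq> {0..fst \<alpha> - fst \<beta>} \<times> UNIV"
    proof clarify
      fix k b x assume x: "x \<in> topspace X" and 1: "prec x (shift (k, b) x)"
        and 2: "\<not> prec (shift \<alpha> x) (shift \<beta> (shift (k, b) x))"
      have "shift \<beta> (shift (k, b) x) = shift (\<beta> + (k, b) - \<alpha>) (shift \<alpha> x)"
        using shift_add_apply[OF x, of "\<beta> + (k, b) - \<alpha>" \<alpha>] shift_add_apply[OF x, of \<beta> "(k, b)"] by simp
      then have "\<not> fst (\<beta> + (k, b) - \<alpha>) > 0" using 2 prec[OF act_in[OF x]] by simp
      moreover have "k \<ge> 0" using 1 prec[OF x] by auto
      ultimately show "k \<in> {0..fst \<alpha> - fst \<beta>} \<and> b \<in> UNIV" by simp
    qed
    moreover have "finite (UNIV :: bit set)"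
      by (rule finite_subset[of _ "{0, 1}"]) (use bit.exhaust in auto)
    ultimately show
      "finite {\<gamma>. \<exists>x\<in>topspace X. prec x (shift \<gamma> x) \<and> \<not> prec (shift \<alpha> x) (shift \<beta> (shift \<gamma> x))}"
      using finite_subset by blast
  qed
  then show thesis by (rule that)
qed

section \<open>The full groups of \<G> and \<H> inside the full group of the action\<close>

abbreviation "\<G> \<equiv> transformation_groupoid X \<phi>"

abbreviation "\<H> \<equiv> semidirect_groupoid \<G> (integer_mod_group 2) (Z2_action X T)"

lemma on_units_Z2_action:
  "on_units \<G> (Z2_action X T 1) = T" "on_units \<G> (Z2_action X T 0) = \<one>\<^bsub>B\<^esub>"
proof -
  have "on_units \<G> (Z2_action X T a) = restrict (T [^]\<^bsub>B\<^esub> a) (topspace X)" for a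
    by (simp add: on_units_def transformation_groupoid_def Z2_action_def)
  moreover have "restrict g (topspace X) = g" if "g \<in> carrier B" for g
    using that by (simp add: BijGroup_carrier_iff extensional_restrict)
  ultimately show "on_units \<G> (Z2_action X T 1) = T" "on_units \<G> (Z2_action X T 0) = \<one>\<^bsub>B\<^esub>"
    using carriers by simp_all
qed

text \<open>The restricted set of displacements records that no \<open>T\<close> occurs; such an
  element composed with one \<open>T\<close> has no fixed point.\<close>

lemma full_group_transformation_groupoid:
  "topological_full_group \<G> \<subseteq> {g \<in> carrier B. full_on (range (\<lambda>n. (n, 0))) g}"
proof -
  let ?C = "range (\<lambda>n. (n, 0)) :: (int \<times> bit) set"
  have "bisection_homeo \<G> U \<in> {g \<in> carrier B. full_on ?C g}" if U: "full_bisection \<G> U" for U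
  \<comment> \<open>The first component of an arrow is its range, so the arrow with source
    \<open>x\<close> and cocycle value \<gamma> starts with \<open>shift \<gamma> x\<close>.\<close>
  proof (rule full_on_bisection_homeo[where c = "\<lambda>(x, n). (n, 0)" and
        e = "\<lambda>\<gamma> x. (shift \<gamma> x, fst \<gamma>)", OF _ _ _ _ _ U])
    show "units \<G> = X" by (simp add: transformation_groupoid_def)
    have "locally_constant (arrows \<G>) ((\<lambda>n. (n, 0)) \<circ> snd)"
      by (rule continuous_map_compose[of _ "discrete_topology UNIV"])
        (simp_all add: transformation_groupoid_def continuous_map_snd)
    then show "locally_constant (arrows \<G>) (\<lambda>(x, n). (n, 0 :: bit))"
      by (simp add: comp_def case_prod_unfold)
    show "continuous_map X (arrows \<G>) (\<lambda>x. (shift \<gamma> x, fst \<gamma>))" for \<gamma>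
      by (simp add: transformation_groupoid_def continuous_map_paired shift_continuous)
  next
    fix g assume "g \<in> topspace (arrows \<G>)"
    then obtain x n where "g = (x, n)" "x \<in> topspace X" by (auto simp: transformation_groupoid_def)
    then show "(case g of (x, n) \<Rightarrow> (n, 0)) \<in> ?C \<and> source_map \<G> g \<in> topspace X \<and>
      range_map \<G> g = shift (case g of (x, n) \<Rightarrow> (n, 0)) (source_map \<G> g) \<and>
      (shift (case g of (x, n) \<Rightarrow> (n, 0)) (source_map \<G> g), fst (case g of (x, n) \<Rightarrow> (n, 0 :: bit))) = g"
      using shift_in act_act_minus[of x "(n, 0)"]
      by (simp add: transformation_groupoid_def flip: shift_int)
  next
    fix \<gamma> :: "int \<times> bit" and x assume "\<gamma> \<in> ?C" "x \<in> topspace X"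
    then show "source_map \<G> (shift \<gamma> x, fst \<gamma>) = x \<and> (case (shift \<gamma> x, fst \<gamma>) of (x, n) \<Rightarrow> (n, 0)) = \<gamma>"
      using act_minus_act[of x \<gamma>] by (auto simp: transformation_groupoid_def simp flip: shift_int)
  qed
  then show ?thesis by (auto simp: topological_full_group_def)
qed

lemma full_group_semidirect_groupoid:
  "topological_full_group \<H> \<subseteq> {g \<in> carrier B. full g}"
proof -
  define c :: "('x \<times> int) \<times> int \<Rightarrow> int \<times> bit" where "c = (\<lambda>((x, n), a). (n, if a = 1 then 1 else 0))"
  define e :: "int \<times> bit \<Rightarrow> 'x \<Rightarrow> ('x \<times> int) \<times> int" where
    "e = (\<lambda>\<gamma> x. ((shift \<gamma> x, fst \<gamma>), if snd \<gamma> = 1 then 1 else 0))"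
  have Z2: "carrier (integer_mod_group 2) = {0, 1}" by (auto simp: carrier_integer_mod_group)
  have arrows: "arrows \<H> = prod_topology (prod_topology X (discrete_topology UNIV)) (discrete_topology {0, 1})"
    by (simp add: semidirect_groupoid_def transformation_groupoid_def Z2)
  have inv2: "inv\<^bsub>integer_mod_group 2\<^esub> 1 = 1" "inv\<^bsub>integer_mod_group 2\<^esub> 0 = 0"
    by (simp_all add: Z2)
  \<comment> \<open>The source map applies \<open>T\<close> after the power of \<phi>,
    \<open>shift\<close> applies it before; the two agree because the action is by an abelian
    group.\<close>
  have src: "source_map \<H> ((x, n), a) = shift (- c ((x, n), a)) x"
    if "x \<in> topspace X" "a \<in> {0, 1}" for x n a
  proof (cases "a = 1")
    case True
    have "source_map \<H> ((x, n), a) = shift (0, 1) (shift (- n, 0) x)"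
      using True inv2 on_units_Z2_action by (simp add: semidirect_groupoid_def transformation_groupoid_def
          shift_one shift_int)
    also have "\<dots> = shift ((0, 1) + (- n, 0)) x" by (simp only: shift_add_apply[OF that(1)])
    finally show ?thesis using True by (simp add: c_def)
  next
    case False
    then have "source_map \<H> ((x, n), a) = shift (- n, 0) x"
      using that inv2 on_units_Z2_action shift_in[OF that(1), of "(- n, 0)"]
      by (simp add: semidirect_groupoid_def transformation_groupoid_def shift_int BijGroup_one_apply)
    then show ?thesis using False by (simp add: c_def)
  qed
  have "bisection_homeo \<H> U \<in> {g \<in> carrier B. full g}" if U: "full_bisection \<H> U" for U
  proof (rule full_on_bisection_homeo[where c = c and e = e, OF _ _ _ _ _ U])
    show "units \<H> = X" by (simp add: semidirect_groupoid_def transformation_groupoid_def)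
    have 1: "locally_constant (arrows \<H>) (\<lambda>g. snd (fst g))" "continuous_map (arrows \<H>) (discrete_topology {0, 1}) snd"
      using continuous_map_compose[OF continuous_map_fst continuous_map_snd]
      by (auto simp: arrows comp_def continuous_map_snd)
    have 2: "locally_constant (arrows \<H>) snd"
      by (rule continuous_map_into_fulltopology) (use 1 in \<open>simp add: subtopology_discrete_topology\<close>)
    have "locally_constant (arrows \<H>) (\<lambda>g. (snd (fst g), if snd g = 1 then 1 else 0 :: bit))"
      using locally_constant_combine[OF 1(1) 2, of "\<lambda>n a. (n, if a = 1 then 1 else 0)"] .
    then show "locally_constant (arrows \<H>) c" by (simp add: c_def case_prod_unfold)
    show "continuous_map X (arrows \<H>) (e \<gamma>)" for \<gamma>
      by (simp add: e_def arrows continuous_map_paired shift_continuous)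
  next
    fix g assume "g \<in> topspace (arrows \<H>)"
    then obtain x n a where g: "g = ((x, n), a)" "x \<in> topspace X" "a \<in> {0, 1}" by (auto simp: arrows)
    then show "c g \<in> UNIV \<and> source_map \<H> g \<in> topspace X \<and>
      range_map \<H> g = shift (c g) (source_map \<H> g) \<and> e (c g) (source_map \<H> g) = g"
      using src[OF g(2,3)] shift_in[OF g(2)] act_act_minus[OF g(2)]
      by (auto simp: semidirect_groupoid_def transformation_groupoid_def e_def c_def simp del: uminus_Pair)
  next
    fix \<gamma> x assume x: "x \<in> topspace X"
    have "c (e \<gamma> x) = \<gamma>" by (cases \<gamma>; cases "snd \<gamma>") (auto simp: c_def e_def)
    moreover have "source_map \<H> (e \<gamma> x) = shift (- c (e \<gamma> x)) (shift \<gamma> x)"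
      using src[OF shift_in[OF x]] by (simp add: e_def)
    ultimately show "source_map \<H> (e \<gamma> x) = x \<and> c (e \<gamma> x) = \<gamma>" using act_minus_act[OF x] by simp
  qed
  then show ?thesis by (auto simp: topological_full_group_def)
qed

end

section \<open>The order unit modulo four\<close>

text \<open>Unlike \<open>coboundaries\<close>, a set of extensional functions, this ignores values
  off \<open>topspace X\<close>, so functions can be combined pointwise without restricting
  them.\<close>

definition is_coboundary :: "'x topology \<Rightarrow> ('x \<Rightarrow> 'x) \<Rightarrow> ('x \<Rightarrow> int) \<Rightarrow> bool" where
  "is_coboundary X \<phi> f \<longleftrightarrow>
     (\<exists>b. locally_constant X b \<and> (\<forall>x\<in>topspace X. f x = b (\<phi> x) - b x))"

lemma is_coboundary_cong:
  "is_coboundary X \<phi> f \<Longrightarrow> (\<And>x. x \<in> topspace X \<Longrightarrow> f x = g x) \<Longrightarrow> is_coboundary X \<phi> g"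
  by (simp add: is_coboundary_def)

lemma is_coboundary_zero: "is_coboundary X \<phi> (\<lambda>x. 0)"
  unfolding is_coboundary_def by (rule exI[of _ "\<lambda>x. 0"]) simp

lemma is_coboundary_combine:
  fixes m n :: int
  assumes "is_coboundary X \<phi> f" "is_coboundary X \<phi> g"
  shows "is_coboundary X \<phi> (\<lambda>x. m * f x + n * g x)"
proof -
  obtain b c where b: "locally_constant X b" "\<forall>x\<in>topspace X. f x = b (\<phi> x) - b x"
    and c: "locally_constant X c" "\<forall>x\<in>topspace X. g x = c (\<phi> x) - c x"
    using assms by (auto simp: is_coboundary_def)
  have "locally_constant X (\<lambda>x. m * b x + n * c x)"
    using locally_constant_combine[OF b(1) c(1), of "\<lambda>s t. m * s + n * t"] .
  moreover have "m * f x + n * g x = (m * b (\<phi> x) + n * c (\<phi> x)) - (m * b x + n * c x)"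
    if "x \<in> topspace X" for x
    using b(2) c(2) that by (simp add: right_diff_distrib)
  ultimately show ?thesis unfolding is_coboundary_def by blast
qed

lemma is_coboundary_diff:
  "is_coboundary X \<phi> f \<Longrightarrow> is_coboundary X \<phi> g \<Longrightarrow> is_coboundary X \<phi> (\<lambda>x. f x - g x)"
  using is_coboundary_combine[of X \<phi> f g 1 "-1"] by simp

lemma is_coboundary_add:
  "is_coboundary X \<phi> f \<Longrightarrow> is_coboundary X \<phi> g \<Longrightarrow> is_coboundary X \<phi> (\<lambda>x. f x + g x)"
  using is_coboundary_combine[of X \<phi> f g 1 1] by simp

lemma H0_class_eq:
  assumes "\<phi> \<in> topspace X \<rightarrow> topspace X"
  shows "H0_class X \<phi> f = {g \<in> extensional (topspace X). is_coboundary X \<phi> (\<lambda>x. g x - f x)}"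
proof (intro equalityI subsetI)
  fix g assume "g \<in> H0_class X \<phi> f"
  then obtain b where b: "b \<in> carrier (integer_functions X)"
    and g: "g = (\<lambda>x\<in>topspace X. (\<lambda>x\<in>topspace X. b (\<phi> x) - b x) x + f x)"
    by (auto simp: H0_class_def r_coset_def coboundaries_def integer_functions_def)
  then show "g \<in> {g \<in> extensional (topspace X). is_coboundary X \<phi> (\<lambda>x. g x - f x)}"
    by (auto simp: is_coboundary_def integer_functions_def)
next
  fix g assume "g \<in> {g \<in> extensional (topspace X). is_coboundary X \<phi> (\<lambda>x. g x - f x)}"
  then obtain b where g: "g \<in> extensional (topspace X)" and b: "locally_constant X b"
    and gb: "\<forall>x\<in>topspace X. g x - f x = b (\<phi> x) - b x" by (auto simp: is_coboundary_def)
  let ?b = "restrict b (topspace X)"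
  have "?b \<in> carrier (integer_functions X)"
    using continuous_map_eq[OF b, of ?b] by (simp add: integer_functions_def)
  then have "(\<lambda>x\<in>topspace X. ?b (\<phi> x) - ?b x) \<in> coboundaries X \<phi>"
    unfolding coboundaries_def by blast
  moreover have "g = (\<lambda>x\<in>topspace X. ?b (\<phi> x) - ?b x) \<otimes>\<^bsub>integer_functions X\<^esub> f"
  proof (rule extensionalityI[OF g])
    fix x assume x: "x \<in> topspace X"
    then have "\<phi> x \<in> topspace X" "g x = b (\<phi> x) - b x + f x" using assms gb by force+
    then show "g x = ((\<lambda>x\<in>topspace X. ?b (\<phi> x) - ?b x) \<otimes>\<^bsub>integer_functions X\<^esub> f) x"
      using x by (simp add: integer_functions_def)
  qed (simp add: integer_functions_def)
  ultimately show "g \<in> H0_class X \<phi> f" unfolding H0_class_def r_coset_def by blast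
qed

lemma H0_class_eqI:
  assumes "\<phi> \<in> topspace X \<rightarrow> topspace X" "is_coboundary X \<phi> (\<lambda>x. f x - g x)"
  shows "H0_class X \<phi> f = H0_class X \<phi> g"
proof -
  have "is_coboundary X \<phi> (\<lambda>x. k x - f x) \<longleftrightarrow> is_coboundary X \<phi> (\<lambda>x. k x - g x)" for k
    using is_coboundary_add[OF _ assms(2), of "\<lambda>x. k x - f x"]
      is_coboundary_diff[OF _ assms(2), of "\<lambda>x. k x - g x"] by auto
  then show ?thesis using H0_class_eq[OF assms(1)] by simp
qed

lemma H0_class_in_carrier:
  "f \<in> carrier (integer_functions X) \<Longrightarrow> H0_class X \<phi> f \<in> carrier (H0 X \<phi>)"
  by (auto simp: H0_def FactGroup_def RCOSETS_def H0_class_def)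

lemma H0_class_mult:
  assumes "\<phi> \<in> topspace X \<rightarrow> topspace X"
  shows "H0_class X \<phi> f \<otimes>\<^bsub>H0 X \<phi>\<^esub> H0_class X \<phi> g = H0_class X \<phi> (\<lambda>x. f x + g x)"
proof -
  have m: "(h \<otimes>\<^bsub>integer_functions X\<^esub> k) = (\<lambda>x\<in>topspace X. h x + k x)" for h k
    by (simp add: integer_functions_def)
  have "H0_class X \<phi> f \<otimes>\<^bsub>H0 X \<phi>\<^esub> H0_class X \<phi> g =
      (\<Union>h\<in>H0_class X \<phi> f. \<Union>k\<in>H0_class X \<phi> g. {\<lambda>x\<in>topspace X. h x + k x})"
    by (simp add: H0_def FactGroup_def set_mult_def m)
  also have "\<dots> = H0_class X \<phi> (\<lambda>x. f x + g x)"
  proof (intro equalityI subsetI)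
    fix e assume "e \<in> (\<Union>h\<in>H0_class X \<phi> f. \<Union>k\<in>H0_class X \<phi> g. {\<lambda>x\<in>topspace X. h x + k x})"
    then obtain h k where e: "e = (\<lambda>x\<in>topspace X. h x + k x)"
      and "is_coboundary X \<phi> (\<lambda>x. h x - f x)" "is_coboundary X \<phi> (\<lambda>x. k x - g x)"
      by (auto simp: H0_class_eq[OF assms])
    from is_coboundary_add[OF this(2,3)]
    have "is_coboundary X \<phi> (\<lambda>x. e x - (f x + g x))" by (rule is_coboundary_cong) (simp add: e)
    then show "e \<in> H0_class X \<phi> (\<lambda>x. f x + g x)" by (simp add: H0_class_eq[OF assms] e)
  next
    fix e assume "e \<in> H0_class X \<phi> (\<lambda>x. f x + g x)"
    then have ext: "e \<in> extensional (topspace X)" and c: "is_coboundary X \<phi> (\<lambda>x. e x - (f x + g x))"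
      by (auto simp: H0_class_eq[OF assms])
    \<comment> \<open>The representative \<open>e\<close> is split as (e - g) + g; the first summand
      carries the whole coboundary.\<close>
    have "restrict (\<lambda>x. e x - g x) (topspace X) \<in> H0_class X \<phi> f"
      unfolding H0_class_eq[OF assms] using is_coboundary_cong[OF c] by simp
    moreover have "restrict g (topspace X) \<in> H0_class X \<phi> g"
      unfolding H0_class_eq[OF assms]
      by (simp add: is_coboundary_cong[OF is_coboundary_zero])
    moreover have "e = (\<lambda>x\<in>topspace X. restrict (\<lambda>x. e x - g x) (topspace X) x + restrict g (topspace X) x)"
      by (rule extensionalityI[OF ext]) auto
    ultimately show "e \<in> (\<Union>h\<in>H0_class X \<phi> f. \<Union>k\<in>H0_class X \<phi> g. {\<lambda>x\<in>topspace X. h x + k x})"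
      by blast
  qed
  finally show ?thesis .
qed

section \<open>The sign of the splitting involution and divisibility by four\<close>

context minimal_with_involution
begin

text \<open>Translations by powers of \<phi> telescope, and the assumption, the triviality of the
  action on H_0 in terms of functions, covers \<open>T\<close>. Every displacement is a power of
  \<phi> after at most one \<open>T\<close>.\<close>

lemma free_action_null_coboundary:
  assumes T_trivial: "\<And>f. locally_constant X f \<Longrightarrow> is_coboundary X \<phi> (\<lambda>x. f (T x) - f x)"
  shows "free_action_null X shift {f. is_coboundary X \<phi> f}"
proof unfold_locales
  fix f :: "'x \<Rightarrow> int" and \<gamma> :: "int \<times> bit" assume f: "locally_constant X f"
  have lc: "locally_constant X (\<lambda>x. f (shift \<gamma> x))" if "locally_constant X f" for f :: "'x \<Rightarrow> int" and \<gamma>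
    using continuous_map_compose[OF shift_continuous that] by (simp add: comp_def)
  obtain k b where \<gamma>: "\<gamma> = (k, b)" by fastforce
  have \<phi>: "is_coboundary X \<phi> (\<lambda>x. f (shift (k, 0) x) - f x)" for k
  proof (induction k rule: int_induct[where k = 0])
    case base
    show ?case
      by (rule is_coboundary_cong[OF is_coboundary_zero])
        (use shift_zero_apply in \<open>simp add: zero_prod_def\<close>)
  next
    case (step1 i)
    have "is_coboundary X \<phi> (\<lambda>x. f (shift (i, 0) (\<phi> x)) - f (shift (i, 0) x))"
      unfolding is_coboundary_def using lc[OF f] by blast
    from is_coboundary_add[OF this step1(2)] show ?case
      by (rule is_coboundary_cong) (use shift_add_apply[of _ "(i, 0)" "(1, 0)"] in \<open>simp add: shift_one\<close>)
  next
    case (step2 i)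
    have "is_coboundary X \<phi> (\<lambda>x. f (shift (i - 1, 0) (\<phi> x)) - f (shift (i - 1, 0) x))"
      unfolding is_coboundary_def using lc[OF f] by blast
    from is_coboundary_diff[OF step2(2) this] show ?case
      by (rule is_coboundary_cong) (use shift_add_apply[of _ "(i - 1, 0)" "(1, 0)"] in \<open>simp add: shift_one\<close>)
  qed
  show "(\<lambda>x. f (shift \<gamma> x) - f x) \<in> {f. is_coboundary X \<phi> f}"
  proof (cases "b = 0")
    case True
    then show ?thesis using \<phi> \<gamma> by simp
  next
    case False
    have "is_coboundary X \<phi> (\<lambda>x. (f (shift (k, 0) (T x)) - f (shift (k, 0) x)) + (f (shift (k, 0) x) - f x))"
      by (intro is_coboundary_add T_trivial lc f \<phi>)
    then have "is_coboundary X \<phi> (\<lambda>x. f (shift \<gamma> x) - f x)"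
      by (rule is_coboundary_cong)
        (use shift_add_apply[of _ "(k, 0)" "(0, 1)"] False in \<open>simp add: shift_one \<gamma>\<close>)
    then show ?thesis by simp
  qed
qed (simp_all add: is_coboundary_zero is_coboundary_diff is_coboundary_cong)

lemma unit_divisible_by_four:
  assumes T_trivial: "\<And>f. locally_constant X f \<Longrightarrow> is_coboundary X \<phi> (\<lambda>x. f (T x) - f x)"
    and \<delta>: "\<delta> \<in> derived_full_group \<G>" and \<beta>: "\<beta> \<in> topological_full_group \<G>"
    and \<beta>T: "\<beta> \<otimes>\<^bsub>B\<^esub> T \<in> derived_full_group \<H>"
    and inv: "(\<delta> \<otimes>\<^bsub>B\<^esub> (\<beta> \<otimes>\<^bsub>B\<^esub> T)) \<otimes>\<^bsub>B\<^esub> (\<delta> \<otimes>\<^bsub>B\<^esub> (\<beta> \<otimes>\<^bsub>B\<^esub> T)) = \<one>\<^bsub>B\<^esub>"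
  shows "\<exists>c. locally_constant X c \<and> is_coboundary X \<phi> (\<lambda>x. 1 - 4 * c x)"
proof -
  let ?C = "range (\<lambda>n. (n, 0)) :: (int \<times> bit) set"
  \<comment> \<open>The functions whose class lies in 2 H_0. The coboundaries themselves stay
    available under the prefix \<open>N\<close>.\<close>
  define Null2 where "Null2 = {f. \<exists>c. locally_constant X c \<and> is_coboundary X \<phi> (\<lambda>x. f x - 2 * c x)}"
  interpret N: free_action_null X shift "{f. is_coboundary X \<phi> f}"
    by (rule free_action_null_coboundary[OF T_trivial])
  have "free_action_null X shift Null2"
  proof unfold_locales
    fix f f' :: "'x \<Rightarrow> int" assume "f \<in> Null2"
    then obtain c where c: "locally_constant X c" "is_coboundary X \<phi> (\<lambda>x. f x - 2 * c x)"
      by (auto simp: Null2_def)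
    show "f' \<in> Null2" if "\<And>x. x \<in> topspace X \<Longrightarrow> f x = f' x"
      using is_coboundary_cong[OF c(2), of "\<lambda>x. f' x - 2 * c x"] c(1) that by (auto simp: Null2_def)
    assume "f' \<in> Null2"
    then obtain c' where c': "locally_constant X c'" "is_coboundary X \<phi> (\<lambda>x. f' x - 2 * c' x)"
      by (auto simp: Null2_def)
    have "is_coboundary X \<phi> (\<lambda>x. (f x - f' x) - 2 * (c x - c' x))"
      by (rule is_coboundary_cong[OF is_coboundary_diff[OF c(2) c'(2)]]) simp
    then show "(\<lambda>x. f x - f' x) \<in> Null2"
      using locally_constant_combine[OF c(1) c'(1), of "(-)"] by (auto simp: Null2_def)
  next
    show "(\<lambda>x. 0) \<in> Null2"
      using is_coboundary_zero by (auto simp: Null2_def intro!: exI[of _ "\<lambda>x. 0"])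
  next
    fix f :: "'x \<Rightarrow> int" and \<gamma> assume "locally_constant X f"
    then have "is_coboundary X \<phi> (\<lambda>x. f (shift \<gamma> x) - f x)" using N.null_shift by blast
    then show "(\<lambda>x. f (shift \<gamma> x) - f x) \<in> Null2"
      unfolding Null2_def by (intro CollectI exI[of _ "\<lambda>x. 0"]) simp
  qed
  moreover have "(\<lambda>x. 2 * f x) \<in> Null2" if "locally_constant X f" for f
    using that is_coboundary_zero by (auto simp: Null2_def intro!: exI[of _ f])
  ultimately obtain prec where "oriented_action X shift Null2 prec"
    by (rule oriented_action_exists)
  then interpret O: oriented_action X shift Null2 prec .
  have u: "units \<G> = X" "units \<H> = X"
    by (simp_all add: transformation_groupoid_def semidirect_groupoid_def)
  have sub: "subgroup {g \<in> carrier B. full_on ?C g} B"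
    by (rule subgroup_full_on) (auto simp: zero_prod_def)
  define \<tau> where "\<tau> = \<delta> \<otimes>\<^bsub>B\<^esub> (\<beta> \<otimes>\<^bsub>B\<^esub> T)"
  have "topological_full_group \<G> \<subseteq> {g \<in> carrier B. full g}"
    using full_group_transformation_groupoid full_on_mono by blast
  then have \<delta>e: "\<delta> \<in> {g \<in> carrier B. O.even_full g}"
    using O.derived_even_full \<delta> by (auto simp: derived_full_group_def u)
  moreover have \<beta>Te: "\<beta> \<otimes>\<^bsub>B\<^esub> T \<in> {g \<in> carrier B. O.even_full g}"
    using O.derived_even_full[OF full_group_semidirect_groupoid] \<beta>T
    by (auto simp: derived_full_group_def u)
  ultimately have \<tau>: "\<tau> \<in> carrier B" "O.even_full \<tau>"
    using subgroup.m_closed[OF O.subgroup_even_full] unfolding \<tau>_def by blast+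
  \<comment> \<open>Evenness says nothing about fixed points. For those, \<delta> and \<beta> both
    come from \<G>, so their product moves points by powers of \<phi> alone.\<close>
  have "\<delta> \<in> {g \<in> carrier B. full_on ?C g}" "\<beta> \<in> {g \<in> carrier B. full_on ?C g}"
    using B.derived_incl[OF full_group_transformation_groupoid sub] \<delta> \<beta>
      full_group_transformation_groupoid by (auto simp: derived_full_group_def u)
  then have \<delta>\<beta>: "\<delta> \<otimes>\<^bsub>B\<^esub> \<beta> \<in> {g \<in> carrier B. full_on ?C g}" and c: "\<delta> \<in> carrier B" "\<beta> \<in> carrier B"
    using subgroup.m_closed[OF sub] by blast+
  have \<tau>_inv: "\<tau> (\<tau> x) = x" if "x \<in> topspace X" for x
    using inv that BijGroup_mult_apply[OF \<tau>(1) \<tau>(1) that] by (simp add: \<tau>_def BijGroup_one_apply)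
  have \<tau>_free: "\<tau> x \<noteq> x" if x: "x \<in> topspace X" for x
  proof
    assume fx: "\<tau> x = x"
    have Tx: "T x \<in> topspace X" using BijGroup_in[OF carriers(2) x] .
    have "\<tau> = (\<delta> \<otimes>\<^bsub>B\<^esub> \<beta>) \<otimes>\<^bsub>B\<^esub> T" using c carriers by (simp add: \<tau>_def B.m_assoc)
    then have "\<tau> x = (\<delta> \<otimes>\<^bsub>B\<^esub> \<beta>) (T x)"
      using BijGroup_mult_apply[of "\<delta> \<otimes>\<^bsub>B\<^esub> \<beta>" _ T x] \<delta>\<beta> carriers x by simp
    moreover obtain n where "(\<delta> \<otimes>\<^bsub>B\<^esub> \<beta>) (T x) = shift (n, 0) (T x)"
      using \<delta>\<beta> Tx unfolding full_on_def by blast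
    ultimately have "shift ((n, 0) + (0, 1)) x = x"
      using fx by (simp only: shift_add_apply[OF x] shift_one)
    then show False using act_free[OF x] by (auto simp: zero_prod_def)
  qed
  have full: "full \<tau>" using \<tau>(2) by (simp add: O.even_full_def)
  define Y where "Y = (\<lambda>x. of_bool (prec x (\<tau> x)) :: int)"
  have "Y \<in> Null2" unfolding Y_def by (rule O.even_involution[OF \<tau>(2) \<tau>_inv \<tau>_free])
  then obtain d where d: "locally_constant X d" "is_coboundary X \<phi> (\<lambda>x. Y x - 2 * d x)"
    by (auto simp: Null2_def)
  have "locally_constant X Y"
    unfolding Y_def by (intro locally_constant_of_bool clopen_pred_kernel[OF O.prec_kernel full])
  \<comment> \<open>This is taken in H_0 and not modulo \<open>Null2\<close>, which would leave an
    error of twice an unknown function.\<close>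
  then have "is_coboundary X \<phi> (\<lambda>x. Y (\<tau> x) - Y x)"
    using N.null_full_shift[OF full] by simp
  \<comment> \<open>With coefficients 1 and 2, the translate of \<open>Y\<close> minus
    \<open>Y\<close> plus 2 (Y - 2 d) is \<open>Y\<close> plus its translate minus 4 d; exactly one
    of \<open>x\<close> and \<open>\<tau> x\<close> precedes the other, so the first two add up to
    1.\<close>
  from is_coboundary_combine[OF this d(2), of 1 2]
  have "is_coboundary X \<phi> (\<lambda>x. 1 - 4 * d x)"
  proof (rule is_coboundary_cong)
    fix x assume x: "x \<in> topspace X"
    obtain \<gamma> where \<gamma>: "\<tau> x = shift \<gamma> x" by (rule full_on_obtain[OF full]) (use x in blast)
    then have "\<gamma> \<noteq> 0" using \<tau>_free[OF x] shift_zero_apply[OF x] by auto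
    then have "prec x (\<tau> x) \<longleftrightarrow> \<not> prec (\<tau> x) x" using O.prec_flip[OF x] \<gamma> by simp
    then have "Y (\<tau> x) + Y x = 1" using \<tau>_inv[OF x] by (simp add: Y_def)
    then show "1 * (Y (\<tau> x) - Y x) + 2 * (Y x - 2 * d x) = 1 - 4 * d x" by simp
  qed
  then show ?thesis using d(1) by blast
qed

text \<open>Triviality is tested on the class of \<open>f\<close>. The map on H_0 composes with the
  inverse of \<open>T\<close>, which is \<open>T\<close> itself.\<close>

lemma T_trivial_of_H0_map:
  assumes "\<forall>c\<in>carrier (H0 X \<phi>). H0_map X T c = c" and f: "locally_constant X f"
  shows "is_coboundary X \<phi> (\<lambda>x. f (T x) - f x)"
proof -
  let ?f = "restrict f (topspace X)"
  have fc: "?f \<in> carrier (integer_functions X)"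
    using continuous_map_eq[OF f, of ?f] by (simp add: integer_functions_def)
  have "?f \<in> H0_class X \<phi> ?f"
    unfolding H0_class_eq[OF \<phi>_funcset] using is_coboundary_zero by simp
  then have "(\<lambda>x\<in>topspace X. ?f (inv_into (topspace X) T x)) \<in> H0_map X T (H0_class X \<phi> ?f)"
    unfolding H0_map_def by blast
  then have "(\<lambda>x\<in>topspace X. ?f (inv_into (topspace X) T x)) \<in> H0_class X \<phi> ?f"
    using assms(1) H0_class_in_carrier[OF fc] by metis
  then have "is_coboundary X \<phi> (\<lambda>x. (\<lambda>x\<in>topspace X. ?f (inv_into (topspace X) T x)) x - ?f x)"
    by (simp only: H0_class_eq[OF \<phi>_funcset] mem_Collect_eq)
  then show ?thesis
  proof (rule is_coboundary_cong)
    fix x assume x: "x \<in> topspace X"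
    have Tx: "T x \<in> topspace X" using BijGroup_in[OF carriers(2) x] .
    have "T (T x) = x"
      using BijGroup_mult_apply[OF carriers(2,2) x] T_T BijGroup_one_apply[OF x] by simp
    then have "inv_into (topspace X) T x = T x"
      using carriers(2) Tx inv_into_f_f by (metis BijGroup_carrier_iff bij_betw_def)
    then show "(\<lambda>x\<in>topspace X. ?f (inv_into (topspace X) T x)) x - ?f x = f (T x) - f x"
      using x Tx by simp
  qed
qed

end

text \<open>As 1 and 4 c differ by a coboundary, the unit of H_0 is four times the class of
  \<open>c\<close>, and a homomorphism carries this over to \<open>u\<close>.\<close>

lemma multiple_four_of_iso:
  assumes D: "comm_group D" and iso: "unital_ordered_iso (H0 X \<phi>) (H0_cone X \<phi>) (H0_unit X \<phi>) D P u"
    and \<phi>: "\<phi> \<in> topspace X \<rightarrow> topspace X"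
    and c: "locally_constant X c" "is_coboundary X \<phi> (\<lambda>x. 1 - 4 * c x)"
  shows "u \<in> multiples 4 D"
proof -
  interpret D: comm_group D by (rule D)
  obtain h where h: "h \<in> hom (H0 X \<phi>) D" "h (H0_unit X \<phi>) = u"
    using iso by (auto simp: unital_ordered_iso_def iso_def)
  \<comment> \<open>\<open>?y n\<close> is n times the class of \<open>c\<close>, given by
    representatives, so that 4 = 1 + 1 + 1 + 1 passes through \<open>h\<close> by
    additivity.\<close>
  let ?f = "\<lambda>n::int. \<lambda>x\<in>topspace X. n * c x"
  let ?y = "\<lambda>n. H0_class X \<phi> (?f n)"
  have car: "?y n \<in> carrier (H0 X \<phi>)" for n
  proof -
    have "locally_constant X (\<lambda>x. n * c x)" using locally_constant_combine[OF c(1) c(1), of "\<lambda>s t. n * s"] .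
    then show ?thesis
      by (intro H0_class_in_carrier) (simp add: integer_functions_def continuous_map_eq)
  qed
  have add: "?y m \<otimes>\<^bsub>H0 X \<phi>\<^esub> ?y n = ?y (m + n)" for m n
    unfolding H0_class_mult[OF \<phi>]
    by (rule H0_class_eqI[OF \<phi> is_coboundary_cong[OF is_coboundary_zero]]) (simp add: algebra_simps)
  have hadd: "h (?y (m + n)) = h (?y m) \<otimes>\<^bsub>D\<^esub> h (?y n)" for m n
    using hom_mult[OF h(1) car car] add by metis
  have hc: "h (?y n) \<in> carrier D" for n using hom_in_carrier[OF h(1) car] .
  have "H0_unit X \<phi> = ?y 4"
    unfolding H0_unit_def by (rule H0_class_eqI[OF \<phi> is_coboundary_cong[OF c(2)]]) simp
  then have "u = h (?y (1 + 1 + 1 + 1))" using h(2) by simp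
  also have "\<dots> = h (?y 1) \<otimes>\<^bsub>D\<^esub> h (?y 1) \<otimes>\<^bsub>D\<^esub> h (?y 1) \<otimes>\<^bsub>D\<^esub> h (?y 1)" by (simp only: hadd)
  also have "\<dots> = h (?y 1) [^]\<^bsub>D\<^esub> (4::nat)" using hc[of 1] by (simp add: numeral_eq_Suc)
  finally show ?thesis using hc[of 1] unfolding multiples_def by blast
qed

theorem mainTheorem9:
  fixes D :: "'d monoid" and Dpos :: "'d set" and u :: 'd
    and X :: "'x topology" and \<phi> T \<beta> :: "'x \<Rightarrow> 'x"
  defines "B \<equiv> BijGroup (topspace X)"
    and "Z2 \<equiv> integer_mod_group 2"
    and "G \<equiv> transformation_groupoid X \<phi>"
    and "lam \<equiv> Z2_action X T"
  defines "H \<equiv> semidirect_groupoid G Z2 lam"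
    and "lamX \<equiv> (\<lambda>a. on_units G (lam a))"
  defines "M \<equiv> derived_full_group G \<union> (derived_full_group G #>\<^bsub>B\<^esub> (\<beta> \<otimes>\<^bsub>B\<^esub> lamX 1))"
  assumes "unital_dimension_group D Dpos u" and "simple_cone D Dpos"
    and "\<not> ordered_iso D Dpos integer_group {0..}"
    and "D Mod multiples 2 D \<cong> Z2"
    and "u \<in> multiples 2 D"
    and "cantor_space X"
    and "\<phi> \<in> homeos X" and "minimal_homeo X \<phi>"
    and "unital_ordered_iso (H0 X \<phi>) (H0_cone X \<phi>) (H0_unit X \<phi>) D Dpos u"
    and "T \<in> homeos X" and "T \<noteq> \<one>\<^bsub>B\<^esub>" and "T \<otimes>\<^bsub>B\<^esub> T = \<one>\<^bsub>B\<^esub>"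
    and "T \<otimes>\<^bsub>B\<^esub> \<phi> = \<phi> \<otimes>\<^bsub>B\<^esub> T"
    and "\<forall>a\<in>carrier Z2. \<forall>c\<in>carrier (H0 X \<phi>). H0_map X (lamX a) c = c"
    and "\<beta> \<in> topological_full_group G"
    and "\<beta> \<otimes>\<^bsub>B\<^esub> lamX 1 \<in> derived_full_group H"
    and "u \<notin> multiples 4 D"
  shows "\<not> extension_splits (B\<lparr>carrier := M\<rparr>)
             (\<lambda>\<gamma>. if \<gamma> \<in> derived_full_group G then 0 else 1) Z2"
proof
  interpret minimal_with_involution X \<phi> T
    by standard (use assms in \<open>simp_all add: B_def\<close>)
  have lamX: "lamX 1 = T" using on_units_Z2_action by (simp add: lamX_def lam_def G_def)
  assume "extension_splits (B\<lparr>carrier := M\<rparr>) (\<lambda>\<gamma>. if \<gamma> \<in> derived_full_group G then 0 else 1) Z2"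
  then obtain \<sigma> where \<sigma>: "\<sigma> \<in> hom Z2 (B\<lparr>carrier := M\<rparr>)"
    and p: "\<forall>q\<in>carrier Z2. (if \<sigma> q \<in> derived_full_group G then 0 else 1) = q"
    by (auto simp: extension_splits_def)
  have c01: "0 \<in> carrier Z2" "1 \<in> carrier Z2" by (simp_all add: Z2_def)
  have \<sigma>mult: "\<sigma> ((a + b) mod 2) = \<sigma> a \<otimes>\<^bsub>B\<^esub> \<sigma> b" if "a \<in> carrier Z2" "b \<in> carrier Z2" for a b
    using hom_mult[OF \<sigma> that] by (simp add: Z2_def)
  have "\<sigma> 0 \<in> derived_full_group G" using p c01(1) by (metis zero_neq_one)
  moreover have "derived_full_group G \<subseteq> carrier B"
    unfolding derived_full_group_def G_def B_def
    using B.derived_in_carrier[of "topological_full_group \<G>"] full_group_transformation_groupoid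
    by (auto simp: transformation_groupoid_def)
  ultimately have "\<sigma> 0 \<in> carrier B" by blast
  \<comment> \<open>\<open>hom\<close> only asks for multiplicativity, so the value at 0 is derived:
    an idempotent of the group \<open>B\<close> is its identity.\<close>
  then have \<sigma>0: "\<sigma> 0 = \<one>\<^bsub>B\<^esub>"
    using \<sigma>mult[OF c01(1,1)] B.l_cancel_one[of "\<sigma> 0" "\<sigma> 0"] unfolding B_def by simp
  have \<sigma>1: "\<sigma> 1 \<otimes>\<^bsub>B\<^esub> \<sigma> 1 = \<one>\<^bsub>B\<^esub>" using \<sigma>mult[OF c01(2,2)] \<sigma>0 by simp
  have "\<sigma> 1 \<notin> derived_full_group G" using p c01(2) by (metis zero_neq_one)
  moreover have "\<sigma> 1 \<in> M" using hom_in_carrier[OF \<sigma> c01(2)] by simp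
  ultimately obtain \<delta> where \<delta>: "\<delta> \<in> derived_full_group G" "\<sigma> 1 = \<delta> \<otimes>\<^bsub>B\<^esub> (\<beta> \<otimes>\<^bsub>B\<^esub> T)"
    by (auto simp: M_def r_coset_def lamX)
  have "\<forall>c\<in>carrier (H0 X \<phi>). H0_map X T c = c" using assms(21) c01(2) lamX by metis
  then have "\<exists>c. locally_constant X c \<and> is_coboundary X \<phi> (\<lambda>x. 1 - 4 * c x)"
    using \<delta> \<sigma>1 assms(22,23) lamX
    by (intro unit_divisible_by_four[of \<delta> \<beta>] T_trivial_of_H0_map)
       (simp_all add: B_def G_def H_def lam_def Z2_def)
  moreover have "comm_group D"
    using assms(8) by (simp add: unital_dimension_group_def ordered_abelian_group_def)
  ultimately have "u \<in> multiples 4 D"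
    using multiple_four_of_iso[OF _ assms(16) \<phi>_funcset] by blast
  then show False using assms(24) by blast
qed

end
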